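(* Let $V\colon\mathbb{R}^2\to\mathbb{R}$ be continuous with $\inf_{\mathbb{R}^2}V>0$, and suppose its distributional derivatives are functions satisfying $|\nabla V(x)|\le CV^{3/2}(x)$ for a.e. $x\in\mathbb{R}^2$ and some constant $C>0$. Let $\{u_n\}_n$ be a bounded sequence in $H^1_V(\mathbb{R}^2)$ such that for some $r>0$, \[ \lim_{n\to+\infty}\sup_{\xi\in\mathbb{R}^2}\int_{B_r(\xi)}V(x)u_n^2\,dx=0 . \] Then $u_n\to0$ strongly in $L^\tau_V(\mathbb{R}^2)$ for every $\tau>2$.
   Context: $H^1_V(\mathbb{R}^2)$ is the completion of $C_0^\infty(\mathbb{R}^2)$ with respect to the norm $\|u\|_V=\left(\int_{\mathbb{R}^2}(|\nabla u|^2+V|u|^2)\,dx\right)^{1/2}$; $L^\tau_V(\mathbb{R}^2)$ is the space of measurable $u$ with $\int V|u|^\tau<\infty$, normed by $\left(\int V|u|^\tau\right)^{1/\tau}$. $B_r(\xi)$ is the open ball of radius $r$ centered at $\xi$. *)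

theory Defs
  imports "HOL-Analysis.Analysis"
begin

definition partial :: "((real^2) \<Rightarrow> real) \<Rightarrow> 2 \<Rightarrow> (real^2) \<Rightarrow> real" where
  "partial f i x = frechet_derivative f (at x) (axis i 1)"

definition grad :: "((real^2) \<Rightarrow> real) \<Rightarrow> (real^2) \<Rightarrow> real^2" where
  "grad f x = (\<chi> i. partial f i x)"

coinductive smooth2 :: "((real^2) \<Rightarrow> real) \<Rightarrow> bool" where
  "(\<forall>x. f differentiable (at x)) \<Longrightarrow> (\<forall>i. smooth2 (partial f i)) \<Longrightarrow> smooth2 f"

definition test_fun :: "((real^2) \<Rightarrow> real) \<Rightarrow> bool" where
  "test_fun f \<longleftrightarrow> smooth2 f \<and> compact (closure {x. f x \<noteq> 0})"

text \<open>Elements of H^1_V as the completion of C_0^infinity: u (with gradient g) is the limit of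
  test functions phi_k with phi_k \<rightarrow> u in L^2_V and grad phi_k \<rightarrow> g in L^2.\<close>
definition H1V :: "((real^2) \<Rightarrow> real) \<Rightarrow> ((real^2) \<Rightarrow> real) \<Rightarrow> ((real^2) \<Rightarrow> real^2) \<Rightarrow> bool" where
  "H1V V u g \<longleftrightarrow> u \<in> borel_measurable lborel \<and> g \<in> borel_measurable lborel \<and>
     (\<exists>\<phi> :: nat \<Rightarrow> (real^2) \<Rightarrow> real. (\<forall>k. test_fun (\<phi> k)) \<and>
        ((\<lambda>k. \<integral>\<^sup>+ x. ennreal (V x * (\<phi> k x - u x)^2) \<partial>lborel) \<longlonglongrightarrow> 0) \<and>
        ((\<lambda>k. \<integral>\<^sup>+ x. ennreal ((norm (grad (\<phi> k) x - g x))^2) \<partial>lborel) \<longlonglongrightarrow> 0))"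

definition H1V_norm2 :: "((real^2) \<Rightarrow> real) \<Rightarrow> ((real^2) \<Rightarrow> real) \<Rightarrow> ((real^2) \<Rightarrow> real^2) \<Rightarrow> ennreal" where
  "H1V_norm2 V u g = (\<integral>\<^sup>+ x. ennreal ((norm (g x))^2 + V x * (u x)^2) \<partial>lborel)"

definition LV_pow :: "((real^2) \<Rightarrow> real) \<Rightarrow> real \<Rightarrow> ((real^2) \<Rightarrow> real) \<Rightarrow> ennreal" where
  "LV_pow V \<tau> u = (\<integral>\<^sup>+ x. ennreal (V x * \<bar>u x\<bar> powr \<tau>) \<partial>lborel)"

end

theory Submission
  imports Defs
begin

text \<open>
  The condition on the weak gradient makes \<open>V\<close> comparable to the constant \<open>V \<xi>\<close> on the ball
  about \<open>\<xi>\<close> of radius \<open>rad \<xi> = \<rho> / sqrt (V \<xi>)\<close>: mollification shows that \<open>V\<close> is Lipschitz with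
  constant \<open>2 C K powr (3/2)\<close> on any ball where \<open>V \<le> K\<close>, and a first-exit argument does the rest.

  For a test function \<open>\<phi>\<close> and a cutoff \<open>\<chi>\<close> supported in that ball, the planar inequality
  \<open>\<integral> f\<^sup>2 \<le> (\<integral> |\<partial>\<^sub>1 f|) (\<integral> |\<partial>\<^sub>2 f|)\<close> applied to \<open>f = \<chi> \<phi> ^ (k+1)\<close>, together with Cauchy--Schwarz, bounds
  \<open>V \<xi> \<integral> \<chi>\<^sup>2 \<phi> ^ (2k+2)\<close> by a multiple of the integral of \<open>V \<phi> ^ (2k)\<close> over the ball times the energy
  in the ball; both terms of \<open>|\<nabla>f|\<close> scale alike because \<open>1 / (rad \<xi>)\<^sup>2\<close> is comparable to \<open>V\<close>.
  Integrating this against \<open>V \<xi> d\<xi>\<close> replaces a covering with bounded overlap and yields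
  \<open>\<integral> V \<phi> ^ (2k+2) \<le> K S E\<close>, where \<open>S\<close> bounds the local integrals of \<open>V \<phi> ^ (2k)\<close> and \<open>E\<close> is the
  total energy. Iterating in \<open>k\<close> and passing to the completion by Fatou, all even powers \<open>\<ge> 4\<close> tend
  to zero; any \<open>\<tau> > 2\<close> follows by interpolation with the bounded \<open>L\<^sup>2\<close> term.
\<close>

section \<open>Smooth bump functions\<close>

lemma smooth2_has_derivative:
  assumes "smooth2 f"
  shows "(f has_derivative (\<lambda>v. \<Sum>i\<in>UNIV. v $ i * partial f i x)) (at x)"
proof -
  have d: "(f has_derivative frechet_derivative f (at x)) (at x)"
    using assms by (metis smooth2.cases frechet_derivative_works)
  have "frechet_derivative f (at x) v = (\<Sum>i\<in>UNIV. v $ i * partial f i x)" for v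
  proof -
    have lin: "linear (frechet_derivative f (at x))"
      using d by (rule has_derivative_linear)
    have "frechet_derivative f (at x) v = frechet_derivative f (at x) (\<Sum>i\<in>UNIV. v $ i *\<^sub>R axis i 1)"
      by (simp add: basis_expansion scalar_mult_eq_scaleR[symmetric])
    then show ?thesis
      by (simp add: linear_sum[OF lin] linear_scale[OF lin] partial_def)
  qed
  then have "frechet_derivative f (at x) = (\<lambda>v. \<Sum>i\<in>UNIV. v $ i * partial f i x)"
    by (rule ext)
  with d show ?thesis by simp
qed

lemma smooth2_continuous_on: "smooth2 f \<Longrightarrow> continuous_on S f"
  by (meson smooth2_has_derivative has_derivative_continuous_on has_derivative_at_withinI)

lemma smooth2_partial: "smooth2 f \<Longrightarrow> smooth2 (partial f i)"
  by (metis smooth2.cases)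

lemma partial_eqI:
  assumes "(f has_derivative D) (at x)"
  shows "partial f i x = D (axis i 1)"
  using frechet_derivative_at[OF assms] by (simp add: partial_def)

lemma partial_shift:
  assumes "smooth2 f"
  shows "partial (\<lambda>y. f (y - z)) i = (\<lambda>y. partial f i (y - z))"
proof
  fix y
  have "((\<lambda>y. f (y - z)) has_derivative (\<lambda>v. \<Sum>i\<in>UNIV. v $ i * partial f i (y - z))) (at y)"
    by (rule has_derivative_compose[of "\<lambda>y. y - z" "\<lambda>v. v", OF _ smooth2_has_derivative[OF assms]])
      (auto intro!: derivative_eq_intros)
  from partial_eqI[OF this, of i] show "partial (\<lambda>y. f (y - z)) i y = partial f i (y - z)"
    by (simp add: axis_def if_distrib if_distribR cong: if_cong)
qed

text \<open>Coinduction succeeds because the translates of smooth functions form a class that is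
  closed under \<open>partial\<close>, by \<open>partial_shift\<close>.\<close>

lemma smooth2_shift: "smooth2 f \<Longrightarrow> smooth2 (\<lambda>y. f (y - z))"
proof (coinduction arbitrary: f)
  case (smooth2 f)
  have "(\<lambda>y. f (y - z)) differentiable (at x)" for x
  proof -
    have "((\<lambda>y. f (y - z)) has_derivative (\<lambda>v. \<Sum>i\<in>UNIV. v $ i * partial f i (x - z))) (at x)"
      by (rule has_derivative_compose[of "\<lambda>y. y - z" "\<lambda>v. v", OF _ smooth2_has_derivative[OF smooth2]])
        (auto intro!: derivative_eq_intros)
    then show ?thesis by (auto simp: differentiable_def)
  qed
  then show ?case
    using smooth2 smooth2_partial[OF smooth2] by (auto simp: partial_shift)
qed

lemma test_fun_shift:
  assumes "test_fun f"
  shows "test_fun (\<lambda>y. f (y - z))"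
proof -
  have eq: "{y. f (y - z) \<noteq> 0} = (+) z ` {y. f y \<noteq> 0}"
    by (force simp: image_iff intro: exI[of _ "_ - z"])
  show ?thesis
    using assms by (simp add: test_fun_def smooth2_shift eq closure_translation compact_translation)
qed

section \<open>Flat functions, with \<open>flat 1\<close> the classical exp(-1/t) extended by zero,
  and the bumps built from them\<close>

definition flat :: "real poly \<Rightarrow> real \<Rightarrow> real" where
  "flat p t = (if t \<le> 0 then 0 else poly p (1 / t) * exp (- (1 / t)))"

lemma poly_exp_tendsto_0: "((\<lambda>s. poly p s * exp (- s)) \<longlongrightarrow> (0::real)) at_top"
proof -
  have "((\<lambda>s. \<Sum>i\<le>degree p. coeff p i * (s ^ i / exp s)) \<longlongrightarrow> (\<Sum>i\<le>degree p. coeff p i * 0)) at_top"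
    by (intro tendsto_sum tendsto_mult tendsto_const tendsto_power_div_exp_0)
  then show ?thesis
    by (simp add: poly_altdef sum_distrib_right exp_minus divide_inverse mult.assoc)
qed

text \<open>Substituting s = 1/t gives d/dt = - s^2 d/ds, and d/ds (p e^(-s)) = (p' - p) e^(-s);
  hence the new polynomial s^2 (p - p'). Exponential decay in s joins the two sides at t =
  0.\<close>

lemma flat_has_derivative:
  "(flat p has_real_derivative flat ([:0, 0, 1:] * (p - pderiv p)) t) (at t)"
proof -
  consider "t < 0" | "t = 0" | "t > 0" by linarith
  then show ?thesis
  proof cases
    case 1
    have "((\<lambda>_. 0) has_real_derivative 0) (at t)" by simp
    then have "(flat p has_real_derivative 0) (at t)"
      by (rule has_field_derivative_transform_within_open[of _ _ _ "{..<0}"])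
        (use 1 in \<open>auto simp: flat_def\<close>)
    then show ?thesis using 1 by (simp add: flat_def)
  next
    case 3
    have "((\<lambda>t. poly p (1 / t) * exp (- (1 / t))) has_real_derivative
        flat ([:0, 0, 1:] * (p - pderiv p)) t) (at t)"
      using 3 by (auto intro!: derivative_eq_intros
          simp: flat_def field_simps power2_eq_square)
    then show ?thesis
      by (rule has_field_derivative_transform_within_open[of _ _ _ "{0<..}"])
        (use 3 in \<open>auto simp: flat_def\<close>)
  next
    case 2
    have "((\<lambda>h. flat p h / h) \<longlongrightarrow> 0) (at_left 0)"
      by (rule tendsto_eventually) (auto simp: flat_def eventually_at_filter)
    moreover have "((\<lambda>h. flat p h / h) \<longlongrightarrow> 0) (at_right 0)"
    proof -
      \<comment> \<open>With s = 1/h, dividing by h multiplies \<open>p\<close> by s, which is what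
        \<open>pCons 0 p\<close> does.\<close>
      have "((\<lambda>h. poly (pCons 0 p) (inverse h) * exp (- inverse h)) \<longlongrightarrow> 0) (at_right 0)"
        by (rule filterlim_compose[OF poly_exp_tendsto_0 filterlim_inverse_at_top_right])
      then show ?thesis
        by (rule tendsto_cong[THEN iffD1, rotated])
          (auto simp: eventually_at_filter flat_def field_simps)
    qed
    ultimately have "((\<lambda>h. flat p h / h) \<longlongrightarrow> 0) (at 0)"
      by (simp add: filterlim_split_at)
    then show ?thesis using 2 by (simp add: DERIV_def flat_def)
  qed
qed

text \<open>The functions \<open>flat p\<close> are closed under differentiation, so the algebra they generate is
  closed under partial derivatives; this is the invariant for the coinductive smoothness proof.\<close>

inductive flat_alg :: "(real^2 \<Rightarrow> real) \<Rightarrow> bool" where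
  flat_alg_base: "flat_alg (\<lambda>x. c * flat p (a + b * x $ i))"
| flat_alg_add: "flat_alg f \<Longrightarrow> flat_alg g \<Longrightarrow> flat_alg (\<lambda>x. f x + g x)"
| flat_alg_mult: "flat_alg f \<Longrightarrow> flat_alg g \<Longrightarrow> flat_alg (\<lambda>x. f x * g x)"

text \<open>\<open>D\<close> takes the direction before the point, so that
  \<open>D (axis i 1)\<close> is a partial derivative as a function of the point and membership in
  the algebra can be asserted of it.\<close>

lemma flat_alg_derivative:
  assumes "flat_alg f"
  shows "\<exists>D. (\<forall>x. (f has_derivative (\<lambda>v. D v x)) (at x)) \<and> (\<forall>i. flat_alg (D (axis i 1)))"
  using assms
proof induction
  case (flat_alg_base c p a b i)
  define q where "q = [:0, 0, 1:] * (p - pderiv p)"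
  define D where "D v x = (c * b * v $ i) * flat q (a + b * x $ i)" for v x :: "real^2"
  have "((\<lambda>x. c * flat p (a + b * x $ i)) has_derivative (\<lambda>v. D v x)) (at x)" for x
  proof -
    have "((\<lambda>x. flat p (a + b * x $ i)) has_derivative (\<lambda>v. flat q (a + b * x $ i) * (b * v $ i))) (at x)"
      by (rule has_derivative_compose[OF _ flat_has_derivative[of p, folded q_def,
              unfolded has_field_derivative_def]])
        (auto intro!: derivative_eq_intros bounded_linear_imp_has_derivative[OF bounded_linear_vec_nth])
    then show ?thesis
      unfolding D_def by (auto intro!: derivative_eq_intros simp: fun_eq_iff)
  qed
  moreover have "flat_alg (D (axis j 1))" for j
    unfolding D_def by (rule flat_alg.flat_alg_base)
  ultimately show ?case by blast
next
  case (flat_alg_add f g)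
  then obtain D E where *: "\<forall>x. (f has_derivative (\<lambda>v. D v x)) (at x)" "\<forall>i. flat_alg (D (axis i 1))"
     "\<forall>x. (g has_derivative (\<lambda>v. E v x)) (at x)" "\<forall>i. flat_alg (E (axis i 1))" by metis
  show ?case
    by (rule exI[of _ "\<lambda>v x. D v x + E v x"])
      (use * in \<open>auto intro!: derivative_intros flat_alg.flat_alg_add\<close>)
next
  case (flat_alg_mult f g)
  then obtain D E where *: "\<forall>x. (f has_derivative (\<lambda>v. D v x)) (at x)" "\<forall>i. flat_alg (D (axis i 1))"
     "\<forall>x. (g has_derivative (\<lambda>v. E v x)) (at x)" "\<forall>i. flat_alg (E (axis i 1))" by metis
  show ?case
    by (rule exI[of _ "\<lambda>v x. f x * E v x + D v x * g x"])
      (use * flat_alg_mult.hyps in \<open>auto intro!: derivative_intros flat_alg.intros\<close>)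
qed

lemma flat_alg_smooth2: "flat_alg f \<Longrightarrow> smooth2 f"
proof (coinduction arbitrary: f)
  case (smooth2 f)
  then obtain D where D: "\<forall>x. (f has_derivative (\<lambda>v. D v x)) (at x)" "\<forall>i. flat_alg (D (axis i 1))"
    using flat_alg_derivative by metis
  have "partial f i = D (axis i 1)" for i
    using D(1) partial_eqI by blast
  with D show ?case by (auto simp: differentiable_def)
qed

text \<open>The factor \<open>k e 1 i\<close> vanishes for x_i \<le> -e and
  \<open>k e (-1) i\<close> for x_i \<ge> e, so the product of all four is positive exactly on an
  open square. The mass is left unnormalised and cancelled where the bump is used.\<close>

lemma bump_exists:
  assumes "e > 0"
  obtains \<eta> :: "real^2 \<Rightarrow> real"
  where "test_fun \<eta>" "\<And>x. \<eta> x \<ge> 0" "\<eta> 0 > 0" "\<And>x i. \<eta> x \<noteq> 0 \<Longrightarrow> \<bar>x $ i\<bar> < e"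
proof
  define k where "k a b i = (\<lambda>x::real^2. 1 * flat 1 (a + b * x $ i))" for a b i
  define \<eta> where "\<eta> = (\<lambda>x. (k e 1 1 x * k e (-1) 1 x) * (k e 1 2 x * k e (-1) 2 x))"
  have supp: "\<bar>x $ i\<bar> < e" if "\<eta> x \<noteq> 0" for x i
    using that exhaust_2[of i] by (auto simp: \<eta>_def k_def flat_def split: if_splits)
  then show "\<And>x i. \<eta> x \<noteq> 0 \<Longrightarrow> \<bar>x $ i\<bar> < e" .
  have "{x. \<eta> x \<noteq> 0} \<subseteq> cbox (\<chi> i. - e) (\<chi> i. e)"
  proof
    fix x assume "x \<in> {x. \<eta> x \<noteq> 0}"
    then have "\<bar>x $ i\<bar> < e" for i using supp by blast
    then show "x \<in> cbox (\<chi> i. - e) (\<chi> i. e)"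
      by (auto simp: mem_box_cart abs_less_iff minus_less_iff intro: less_imp_le)
  qed
  then have "bounded {x. \<eta> x \<noteq> 0}"
    using bounded_cbox bounded_subset by blast
  moreover have "smooth2 \<eta>"
    unfolding \<eta>_def k_def by (intro flat_alg_smooth2 flat_alg.intros)
  ultimately show "test_fun \<eta>" by (simp add: test_fun_def compact_closure)
  show "\<eta> x \<ge> 0" for x by (simp add: \<eta>_def k_def flat_def)
  show "\<eta> 0 > 0" using assms by (simp add: \<eta>_def k_def flat_def)
qed

section \<open>Weak gradients and local comparability of the weight\<close>

lemma partial_eq_0_outside:
  assumes "smooth2 f" "closed S" "\<And>x. f x \<noteq> 0 \<Longrightarrow> x \<in> S" "x \<notin> S"
  shows "partial f i x = 0"
proof -
  have "(f has_derivative (\<lambda>_. 0)) (at x)"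
    by (rule has_derivative_transform_within_open[of "\<lambda>_. 0" _ _ _ "- S"])
      (use assms in auto)
  from partial_eqI[OF this] show ?thesis by simp
qed

text \<open>Passes from the Lebesgue integral over the whole space to a gauge integral over a box,
  where the Leibniz rule for parameter integrals applies.\<close>

lemma
  fixes f :: "'a::euclidean_space \<Rightarrow> real"
  assumes "continuous_on UNIV f" "\<And>x. f x \<noteq> 0 \<Longrightarrow> x \<in> cbox a b"
  shows integrable_continuous_support: "integrable lborel f"
    and integral_continuous_support: "(\<integral>x. f x \<partial>lborel) = integral (cbox a b) f"
proof -
  have eq: "(\<lambda>x. indicator (cbox a b) x *\<^sub>R f x) = f"
    using assms(2) by (auto simp: indicator_def fun_eq_iff)
  have si: "set_integrable lborel (cbox a b) f"
    unfolding set_integrable_def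
    by (rule borel_integrable_compact) (auto intro: continuous_on_subset[OF assms(1)])
  then show "integrable lborel f" by (simp only: set_integrable_def eq)
  from set_borel_integral_eq_integral(2)[OF si]
  show "(\<integral>x. f x \<partial>lborel) = integral (cbox a b) f"
    by (simp only: set_lebesgue_integral_def eq)
qed

lemma lborel_integral_shift:
  fixes f :: "'a::euclidean_space \<Rightarrow> real"
  assumes "f \<in> borel_measurable borel"
  shows "(\<integral>x. f (x - z) \<partial>lborel) = (\<integral>x. f x \<partial>lborel)"
proof -
  have "(\<integral>x. f x \<partial>lborel) = (\<integral>x. f x \<partial>distr lborel borel ((+) (- z)))"
    by (simp add: lborel_distr_plus)
  also have "\<dots> = (\<integral>x. f (x - z) \<partial>lborel)"
    using assms by (subst integral_distr) auto
  finally show ?thesis ..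
qed

lemma test_fun_cbox:
  assumes "test_fun f"
  obtains a b where "\<And>x. f x \<noteq> 0 \<Longrightarrow> x \<in> cbox a b" "\<And>x i. partial f i x \<noteq> 0 \<Longrightarrow> x \<in> cbox a b"
proof -
  have "bounded (closure {x. f x \<noteq> 0})"
    using assms compact_imp_bounded by (auto simp: test_fun_def)
  then obtain a where "closure {x. f x \<noteq> 0} \<subseteq> cbox (-a) a"
    by (metis bounded_subset_cbox_symmetric)
  then have "\<And>x. f x \<noteq> 0 \<Longrightarrow> x \<in> cbox (-a) a"
    using closure_subset by fastforce
  moreover have "\<And>x i. partial f i x \<noteq> 0 \<Longrightarrow> x \<in> cbox (-a) a"
    using partial_eq_0_outside[of f "cbox (-a) a"] assms calculation closed_cbox
    by (auto simp: test_fun_def)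
  ultimately show ?thesis using that by blast
qed

text \<open>At almost every point where \<open>f\<close> is nonzero the components of
  \<open>G\<close> are at most \<open>C * K powr (3/2)\<close>; a local bound on \<open>V\<close>
  thus controls averages of \<open>G\<close> against a localised kernel.\<close>

lemma integral_weak_grad_bound:
  fixes V :: "real^2 \<Rightarrow> real" and G :: "real^2 \<Rightarrow> real^2"
  assumes Vpos: "\<And>x. V x \<ge> 0"
    and G: "AE x in lborel. norm (G x) \<le> C * V x powr (3/2)"
    and C: "C \<ge> 0" and f: "integrable lborel f" "\<And>x. f x \<ge> 0"
    and K: "\<And>x. f x \<noteq> 0 \<Longrightarrow> V x \<le> K"
  shows "\<bar>\<integral>x. G x $ i * f x \<partial>lborel\<bar> \<le> C * K powr (3/2) * (\<integral>x. f x \<partial>lborel)"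
proof -
  have le: "AE x in lborel. \<bar>G x $ i * f x\<bar> \<le> C * K powr (3/2) * f x"
    using G
  proof eventually_elim
    case (elim x)
    show ?case
    proof (cases "f x = 0")
      case False
      have "\<bar>G x $ i\<bar> \<le> C * V x powr (3/2)"
        using elim component_le_norm_cart order_trans by blast
      also have "\<dots> \<le> C * K powr (3/2)"
        using C K[OF False] Vpos[of x] by (intro mult_left_mono powr_mono2) auto
      finally show ?thesis using f(2)[of x] by (simp add: abs_mult mult_right_mono)
    qed auto
  qed
  have "\<bar>\<integral>x. G x $ i * f x \<partial>lborel\<bar> \<le> (\<integral>x. \<bar>G x $ i * f x\<bar> \<partial>lborel)"
    by (rule integral_abs_bound)
  also have "\<dots> \<le> (\<integral>x. C * K powr (3/2) * f x \<partial>lborel)"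
    using le f C by (intro integral_mono_AE') auto
  finally show ?thesis by simp
qed

lemma norm_le_of_components:
  fixes w :: "real^2"
  assumes "\<And>i. \<bar>w $ i\<bar> \<le> e"
  shows "norm w \<le> 2 * e"
  using norm_le_l1_cart[of w] assms[of 1] assms[of 2] by (simp add: UNIV_2)

text \<open>\<open>V\<close> is merely continuous, so the derivative in t falls on the kernel; the
  minus sign is the inner derivative of w - (x + t v). The result is stated with
  \<open>partial\<close> of a translated test function, ready for the weak gradient
  identity.\<close>

lemma mollified_derivative:
  fixes V :: "real^2 \<Rightarrow> real" and x v :: "real^2"
  assumes V: "continuous_on UNIV V" and \<eta>: "test_fun \<eta>"
  defines "F \<equiv> \<lambda>t. \<integral>w. V w * \<eta> (w - (x + t *\<^sub>R v)) \<partial>lborel"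
  shows "(F has_real_derivative
      - (\<Sum>i\<in>UNIV. v $ i * (\<integral>w. V w * partial (\<lambda>w. \<eta> (w - (x + t *\<^sub>R v))) i w \<partial>lborel))) (at t)"
proof -
  define z where "z t = x + t *\<^sub>R v" for t
  have sm: "smooth2 \<eta>" using \<eta> by (simp add: test_fun_def)
  note [continuous_intros] =
    continuous_on_compose2[OF smooth2_continuous_on[OF sm, of UNIV]]
    continuous_on_compose2[OF smooth2_continuous_on[OF smooth2_partial[OF sm], of UNIV]]
    continuous_on_compose2[OF V]
  obtain a0 b0 where supp: "\<And>x. \<eta> x \<noteq> 0 \<Longrightarrow> x \<in> cbox a0 b0" "\<And>x i. partial \<eta> i x \<noteq> 0 \<Longrightarrow> x \<in> cbox a0 b0"
    using test_fun_cbox[OF \<eta>] by metis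
  \<comment> \<open>A compact range of parameters around \<open>t\<close> keeps all translated
    supports in one box, as the Leibniz rule requires a fixed domain.\<close>
  define U where "U = {t - 1 .. t + 1}"
  have "compact ((\<lambda>(w, s). w + z s) ` (cbox a0 b0 \<times> U))"
    unfolding z_def U_def by (intro compact_continuous_image compact_Times)
      (auto intro!: continuous_intros simp: split_beta)
  then obtain a where a: "(\<lambda>(w, s). w + z s) ` (cbox a0 b0 \<times> U) \<subseteq> cbox (-a) a"
    by (metis bounded_subset_cbox_symmetric compact_imp_bounded)
  have in_cbox: "w \<in> cbox (-a) a" if "w - z s \<in> cbox a0 b0" "s \<in> U" for w s
  proof -
    have "w = (\<lambda>(w, s). w + z s) (w - z s, s)" by simp
    then have "w \<in> (\<lambda>(w, s). w + z s) ` (cbox a0 b0 \<times> U)" using that by blast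
    with a show ?thesis by blast
  qed
  have pz: "partial (\<lambda>w. \<eta> (w - z s)) i = (\<lambda>w. partial \<eta> i (w - z s))" for s i
    by (rule partial_shift[OF sm])
  define Fx where "Fx s w = V w * - (\<Sum>i\<in>UNIV. v $ i * partial \<eta> i (w - z s))" for s w
  have F_eq: "F s = integral (cbox (-a) a) (\<lambda>w. V w * \<eta> (w - z s))" if "s \<in> U" for s
    unfolding F_def z_def[symmetric]
    by (rule integral_continuous_support)
      (auto intro!: continuous_intros in_cbox[OF _ that] supp(1))
  have "((\<lambda>s. integral (cbox (-a) a) (\<lambda>w. V w * \<eta> (w - z s)))
      has_real_derivative integral (cbox (-a) a) (Fx t)) (at t within U)"
  proof (rule leibniz_rule_field_derivative)
    fix s w assume "s \<in> U" "w \<in> cbox (-a) a"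
    have "((\<lambda>s. \<eta> (w - z s)) has_derivative (\<lambda>h. \<Sum>i\<in>UNIV. (- (h *\<^sub>R v)) $ i * partial \<eta> i (w - z s))) (at s)"
      by (rule has_derivative_compose[OF _ smooth2_has_derivative[OF sm]])
        (auto intro!: derivative_eq_intros simp: z_def)
    then have "((\<lambda>s. \<eta> (w - z s)) has_real_derivative - (\<Sum>i\<in>UNIV. v $ i * partial \<eta> i (w - z s))) (at s)"
      unfolding has_field_derivative_def
      by (rule has_derivative_eq_rhs)
        (auto simp: fun_eq_iff sum_distrib_left sum_distrib_right sum_negf[symmetric] mult.assoc mult.left_commute
          mult.commute intro!: sum.cong)
    then have "((\<lambda>s. V w * \<eta> (w - z s)) has_real_derivative Fx s w) (at s)"
      unfolding Fx_def by (rule DERIV_cmult)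
    then show "((\<lambda>s. V w * \<eta> (w - z s)) has_real_derivative Fx s w) (at s within U)"
      by (rule has_field_derivative_at_within)
  next
    fix s show "(\<lambda>w. V w * \<eta> (w - z s)) integrable_on cbox (-a) a"
      by (intro integrable_continuous continuous_intros) auto
  next
    show "continuous_on (U \<times> cbox (-a) a) (\<lambda>(s, w). Fx s w)"
      unfolding Fx_def z_def split_beta by (intro continuous_intros) auto
  qed (auto simp: U_def)
  then have "(F has_real_derivative integral (cbox (-a) a) (Fx t)) (at t within U)"
    unfolding has_field_derivative_def
    by (rule has_derivative_transform[rotated 2]) (auto simp: F_eq U_def)
  moreover have "t \<in> interior U" by (simp add: U_def)
  ultimately have "(F has_real_derivative integral (cbox (-a) a) (Fx t)) (at t)"
    using at_within_interior by metis
  moreover have "integral (cbox (-a) a) (Fx t) =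
      - (\<Sum>i\<in>UNIV. v $ i * (\<integral>w. V w * partial (\<lambda>w. \<eta> (w - z t)) i w \<partial>lborel))"
  proof -
    have tU: "t \<in> U" by (simp add: U_def)
    have part: "(\<integral>w. V w * partial (\<lambda>w. \<eta> (w - z t)) i w \<partial>lborel) =
        integral (cbox (-a) a) (\<lambda>w. V w * partial \<eta> i (w - z t))" for i
      unfolding pz by (rule integral_continuous_support)
        (auto intro!: continuous_intros in_cbox[OF _ tU] supp)
    have int: "(\<lambda>w. V w * partial \<eta> i (w - z t)) integrable_on cbox (-a) a" for i
      by (intro integrable_continuous continuous_intros) auto
    have "Fx t = (\<lambda>w. - (\<Sum>i\<in>UNIV. v $ i * (V w * partial \<eta> i (w - z t))))"
      by (auto simp: Fx_def fun_eq_iff sum_distrib_left mult.left_commute)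
    then show ?thesis
      unfolding part by (simp add: integral_sum integrable_on_mult_right int)
  qed
  ultimately show ?thesis by (simp add: z_def)
qed

text \<open>Along the segment from \<open>x\<close> to \<open>y\<close> the mollified
  \<open>V\<close> has as derivative an average of \<open>G\<close> paired with y - x; the factor 2
  comes from bounding each of the two coordinates of y - x by the norm. Shrinking the kernel
  recovers \<open>V\<close> by continuity.\<close>

lemma lipschitz_of_weak_grad:
  fixes V :: "real^2 \<Rightarrow> real" and G :: "real^2 \<Rightarrow> real^2"
  assumes V: "continuous_on UNIV V" and Vpos: "\<And>x. V x \<ge> 0"
    and weak: "\<And>\<phi> i. test_fun \<phi> \<Longrightarrow>
             (\<integral>x. V x * partial \<phi> i x \<partial>lborel) = - (\<integral>x. G x $ i * \<phi> x \<partial>lborel)"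
    and G: "AE x in lborel. norm (G x) \<le> C * V x powr (3/2)"
    and C: "C \<ge> 0" and K: "\<And>x. x \<in> ball \<xi> R \<Longrightarrow> V x \<le> K"
    and xy: "x \<in> ball \<xi> R" "y \<in> ball \<xi> R"
  shows "\<bar>V x - V y\<bar> \<le> 2 * C * K powr (3/2) * norm (y - x)"
proof (rule field_le_epsilon)
  fix \<delta>' :: real assume "\<delta>' > 0"
  \<comment> \<open>Each endpoint contributes an error \<open>\<delta>\<close>, hence half of the
    tolerance.\<close>
  define \<delta> where "\<delta> = \<delta>' / 2"
  have \<delta>: "\<delta> > 0" using \<open>\<delta>' > 0\<close> by (simp add: \<delta>_def)
  obtain dx where dx: "dx > 0" "\<And>w. norm (w - x) < dx \<Longrightarrow> \<bar>V w - V x\<bar> < \<delta>"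
    using V \<delta> unfolding continuous_on_iff by (metis UNIV_I dist_norm real_norm_def)
  obtain dy where dy: "dy > 0" "\<And>w. norm (w - y) < dy \<Longrightarrow> \<bar>V w - V y\<bar> < \<delta>"
    using V \<delta> unfolding continuous_on_iff by (metis UNIV_I dist_norm real_norm_def)
  \<comment> \<open>Within distance \<open>m\<close> of \<open>x\<close> or \<open>y\<close> the
    value of \<open>V\<close> changes by less than \<open>\<delta>\<close> and the ball is not left.
    A kernel on the square of half-side \<open>e\<close> reaches norm at most 2e < m.\<close>
  define m where "m = Min {dx, dy, R - dist \<xi> x, R - dist \<xi> y}"
  define e where "e = m / 3"
  have m: "m > 0" "m \<le> dx" "m \<le> dy" "m \<le> R - dist \<xi> x" "m \<le> R - dist \<xi> y"
    using dx dy xy by (auto simp: m_def)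
  have e: "e > 0" "2 * e < m" using m by (auto simp: e_def)
  obtain \<eta> :: "real^2 \<Rightarrow> real"
    where \<eta>: "test_fun \<eta>" "\<And>x. \<eta> x \<ge> 0" "\<eta> 0 > 0" "\<And>x i. \<eta> x \<noteq> 0 \<Longrightarrow> \<bar>x $ i\<bar> < e"
    using bump_exists[OF e(1)] by metis
  have near: "norm w < m" if "\<eta> w \<noteq> 0" for w
    using norm_le_of_components[of w e] \<eta>(4)[OF that] e by (meson less_imp_le le_less_trans)
  have c\<eta>: "continuous_on UNIV \<eta>"
    using \<eta>(1) smooth2_continuous_on by (auto simp: test_fun_def)
  then have m\<eta> [measurable]: "\<eta> \<in> borel_measurable borel"
    by (rule borel_measurable_continuous_onI)
  obtain a b where ab: "\<And>x. \<eta> x \<noteq> 0 \<Longrightarrow> x \<in> cbox a b"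
    using test_fun_cbox[OF \<eta>(1)] by metis
  \<comment> \<open>\<open>J\<close> is the mass of the kernel; the estimates carry this factor
    until it is cancelled at the end.\<close>
  define J where "J = (\<integral>x. \<eta> x \<partial>lborel)"
  have shiftint: "integrable lborel (\<lambda>w. f w * \<eta> (w - z))" if "continuous_on UNIV f" for f z
    by (rule integrable_continuous_support[of _ "a + z" "b + z"])
      (use ab in \<open>auto intro!: continuous_intros that continuous_on_compose2[OF c\<eta>]
         simp: mem_box algebra_simps inner_simps dest!: ab\<close>)
  have shiftint1: "integrable lborel (\<lambda>w. \<eta> (w - z))" for z
    using shiftint[of "\<lambda>_. 1"] by simp
  have J_shift: "(\<integral>w. \<eta> (w - z) \<partial>lborel) = J" for z
    unfolding J_def by (rule lborel_integral_shift) auto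
  have J: "J > 0"
  proof -
    have "J \<ge> 0" unfolding J_def using \<eta>(2) by simp
    moreover have "J \<noteq> 0"
    proof
      assume "J = 0"
      then have "AE x in lborel. \<eta> x = 0"
        using shiftint1[of 0] \<eta>(2) unfolding J_def
        by (subst (asm) integral_nonneg_eq_0_iff_AE) auto
      then have "{x. \<eta> x \<noteq> 0} \<in> null_sets lborel"
        by (subst AE_iff_null_sets) auto
      moreover have "open {x. \<eta> x \<noteq> 0}"
        using open_Collect_neq[OF c\<eta> continuous_on_const] .
      moreover have "{x. \<eta> x \<noteq> 0} \<noteq> {}" using \<eta>(3) by force
      ultimately show False
        by (metis negligible_iff_null_sets null_sets_completionI open_not_negligible)
    qed
    ultimately show ?thesis by simp
  qed
  define z where "z t = x + t *\<^sub>R (y - x)" for t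
  define F where "F t = (\<integral>w. V w * \<eta> (w - z t) \<partial>lborel)" for t
  define L where "L = 2 * C * K powr (3/2) * norm (y - x)"
  have approx: "\<bar>(\<integral>w. V w * \<eta> (w - p) \<partial>lborel) - J * V p\<bar> \<le> \<delta> * J"
    if "\<And>w. norm (w - p) < m \<Longrightarrow> \<bar>V w - V p\<bar> < \<delta>" for p
  proof -
    have "(\<integral>w. V w * \<eta> (w - p) \<partial>lborel) - J * V p = (\<integral>w. V w * \<eta> (w - p) - V p * \<eta> (w - p) \<partial>lborel)"
      by (subst Bochner_Integration.integral_diff)
        (auto simp: J_shift intro!: shiftint V shiftint1)
    also have "\<bar>\<dots>\<bar> \<le> (\<integral>w. \<bar>V w * \<eta> (w - p) - V p * \<eta> (w - p)\<bar> \<partial>lborel)"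
      by (rule integral_abs_bound)
    also have "\<dots> \<le> (\<integral>w. \<delta> * \<eta> (w - p) \<partial>lborel)"
    proof (rule integral_mono_AE')
      show "integrable lborel (\<lambda>w. \<delta> * \<eta> (w - p))" using shiftint1 by simp
      show "AE w in lborel. \<bar>V w * \<eta> (w - p) - V p * \<eta> (w - p)\<bar> \<le> \<delta> * \<eta> (w - p)"
      proof (rule AE_I2)
        fix w
        show "\<bar>V w * \<eta> (w - p) - V p * \<eta> (w - p)\<bar> \<le> \<delta> * \<eta> (w - p)"
          using near[of "w - p"] that[of w] \<eta>(2)[of "w - p"]
          by (cases "\<eta> (w - p) = 0") (auto simp: left_diff_distrib[symmetric] abs_mult mult_right_mono)
      qed
    qed (use \<delta> \<eta>(2) in auto)
    also have "\<dots> = \<delta> * J" by (simp add: J_shift)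
    finally show ?thesis .
  qed
  \<comment> \<open>Mean value inequality on the segment: the weak identity trades the derivative of
    the kernel for \<open>G\<close>, and its minus sign cancels the one in \<open>D\<close>.\<close>
  have "norm (F 1 - F 0) \<le> L * J * norm (1 - 0 :: real)"
  proof (rule differentiable_bound[of "{0..1}"])
    fix t :: real assume t: "t \<in> {0..1}"
    define D where "D = - (\<Sum>i\<in>UNIV. (y - x) $ i * (\<integral>w. V w * partial (\<lambda>w. \<eta> (w - z t)) i w \<partial>lborel))"
    have "(F has_real_derivative D) (at t)"
      unfolding F_def D_def z_def by (rule mollified_derivative[OF V \<eta>(1)])
    then show "(F has_derivative (*) D) (at t within {0..1})"
      by (simp add: has_field_derivative_def has_derivative_at_withinI)
    have tf: "test_fun (\<lambda>w. \<eta> (w - z t))" by (rule test_fun_shift[OF \<eta>(1)])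
    have "D = (\<Sum>i\<in>UNIV. (y - x) $ i * (\<integral>w. G w $ i * \<eta> (w - z t) \<partial>lborel))"
      by (simp add: D_def weak[OF tf] sum_negf)
    also have "\<bar>\<dots>\<bar> \<le> (\<Sum>i\<in>UNIV. \<bar>(y - x) $ i * (\<integral>w. G w $ i * \<eta> (w - z t) \<partial>lborel)\<bar>)"
      by (rule sum_abs)
    also have "\<dots> \<le> (\<Sum>i\<in>(UNIV::2 set). norm (y - x) * (C * K powr (3/2) * J))"
    proof (rule sum_mono)
      fix i :: 2
      have "V w \<le> K" if "\<eta> (w - z t) \<noteq> 0" for w
      proof (rule K)
        \<comment> \<open>Convexity of the smaller closed ball keeps the segment at depth
          \<open>m\<close>, so the kernel supports stay where \<open>V \<le> K\<close> is
          known.\<close>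
        have "dist \<xi> (z t) \<le> R - m"
        proof -
          have "z t \<in> cball \<xi> (R - m)"
          proof -
            have "x \<in> cball \<xi> (R - m)" "y \<in> cball \<xi> (R - m)" using m by auto
            then have "(1 - t) *\<^sub>R x + t *\<^sub>R y \<in> cball \<xi> (R - m)"
              using t by (intro convexD[OF convex_cball]) auto
            then show ?thesis by (simp add: z_def algebra_simps)
          qed
          then show ?thesis by simp
        qed
        then show "w \<in> ball \<xi> R"
          using near[OF that] dist_triangle[of \<xi> w "z t"] by (simp add: dist_norm norm_minus_commute)
      qed
      then have "\<bar>\<integral>w. G w $ i * \<eta> (w - z t) \<partial>lborel\<bar> \<le> C * K powr (3/2) * (\<integral>w. \<eta> (w - z t) \<partial>lborel)"
        by (intro integral_weak_grad_bound[OF Vpos G C shiftint1 \<eta>(2)]) auto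
      then show "\<bar>(y - x) $ i * (\<integral>w. G w $ i * \<eta> (w - z t) \<partial>lborel)\<bar> \<le> norm (y - x) * (C * K powr (3/2) * J)"
        unfolding J_shift abs_mult by (intro mult_mono component_le_norm_cart) auto
    qed
    also have "\<dots> = L * J" by (simp add: L_def)
    finally have "\<bar>D\<bar> \<le> L * J" .
    then show "onorm ((*) D) \<le> L * J"
      by (intro onorm_le) (simp add: abs_mult mult_right_mono)
  qed auto
  moreover have "\<bar>F 0 - J * V x\<bar> \<le> \<delta> * J"
    using approx[of x] dx m by (fastforce simp: F_def z_def)
  moreover have "\<bar>F 1 - J * V y\<bar> \<le> \<delta> * J"
    using approx[of y] dy m by (fastforce simp: F_def z_def)
  ultimately have "\<bar>J * V x - J * V y\<bar> \<le> L * J + 2 * (\<delta> * J)" by simp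
  then have "J * \<bar>V x - V y\<bar> \<le> J * L + J * \<delta>'"
    using J unfolding right_diff_distrib[symmetric] abs_mult \<delta>_def by (simp add: algebra_simps)
  then show "\<bar>V x - V y\<bar> \<le> 2 * C * K powr (3/2) * norm (y - x) + \<delta>'"
    using J unfolding distrib_left[symmetric] by (simp add: L_def)
qed

text \<open>As long as \<open>V\<close> stays below 2A, with A = V \<xi>, its Lipschitz constant is
  2 C (2A)^(3/2); over a distance 1/(12 C sqrt A) it moves by at most A 2^(3/2)/6 < A/2, too little
  to reach 2A. The number 12 is chosen for this.\<close>

lemma comparable_of_weak_grad:
  fixes V :: "real^2 \<Rightarrow> real" and G :: "real^2 \<Rightarrow> real^2"
  assumes V: "continuous_on UNIV V" and Vpos: "\<And>x. V x > 0"
    and weak: "\<And>\<phi> i. test_fun \<phi> \<Longrightarrow>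
             (\<integral>x. V x * partial \<phi> i x \<partial>lborel) = - (\<integral>x. G x $ i * \<phi> x \<partial>lborel)"
    and G: "AE x in lborel. norm (G x) \<le> C * V x powr (3/2)"
    and C: "C > 0" 
    and near: "dist \<xi> x \<le> 1 / (12 * C * sqrt (V \<xi>))"
  shows "V \<xi> / 2 \<le> V x" "V x \<le> 2 * V \<xi>"
proof -
  define A where "A = V \<xi>"
  define \<rho> where "\<rho> = 1 / (12 * C * sqrt A)"
  have A: "A > 0" using Vpos by (simp add: A_def)
  have \<rho>: "\<rho> > 0" using A C by (simp add: \<rho>_def)
  \<comment> \<open>The Lipschitz bound holds on the open ball; continuity extends it to the
    closure, since the exit point used below lies on the boundary.\<close>
  have step: "\<bar>V y - A\<bar> \<le> A / 2"
    if "\<And>w. w \<in> ball \<xi> R \<Longrightarrow> V w \<le> 2 * A" "dist \<xi> y \<le> R" "R > 0" "dist \<xi> y \<le> \<rho>" for R y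
  proof -
    have "\<bar>V w - A\<bar> \<le> 2 * C * (2 * A) powr (3/2) * norm (\<xi> - w)" if "w \<in> ball \<xi> R" for w
      unfolding A_def using that \<open>R > 0\<close> \<open>\<And>w. w \<in> ball \<xi> R \<Longrightarrow> V w \<le> 2 * A\<close> Vpos C
      by (intro lipschitz_of_weak_grad[OF V _ weak G]) (auto simp: A_def intro: less_imp_le)
    moreover have "y \<in> closure (ball \<xi> R)" using that by (simp add: closure_ball)
    moreover have "continuous_on (closure (ball \<xi> R)) (\<lambda>w. \<bar>V w - A\<bar> - 2 * C * (2 * A) powr (3/2) * norm (\<xi> - w))"
      by (intro continuous_intros continuous_on_subset[OF V]) auto
    ultimately have "\<bar>V y - A\<bar> - 2 * C * (2 * A) powr (3/2) * norm (\<xi> - y) \<le> 0"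
      by (intro continuous_le_on_closure[of "ball \<xi> R"
            "\<lambda>w. \<bar>V w - A\<bar> - 2 * C * (2 * A) powr (3/2) * norm (\<xi> - w)" y 0]) auto
    then have "\<bar>V y - A\<bar> \<le> 2 * C * (2 * A) powr (3/2) * norm (\<xi> - y)" by simp
    also have "\<dots> \<le> 2 * C * (2 * A) powr (3/2) * \<rho>"
      using that C by (intro mult_left_mono) (auto simp: dist_norm)
    also have "\<dots> = A * (2 powr (3/2) / 6)"
    proof -
      have "A powr (3/2) = A * sqrt A"
        using A powr_add[of A 1 "1/2"] by (simp add: powr_half_sqrt)
      then show ?thesis using A C by (simp add: powr_mult \<rho>_def field_simps)
    qed
    also have "\<dots> \<le> A * (1 / 2)"
    proof -
      have "(2::real) powr (3/2) = 2 * sqrt 2"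
        using powr_add[of 2 1 "1/2::real"] by (simp add: powr_half_sqrt)
      moreover have "sqrt 2 \<le> 3/2" by (rule real_le_lsqrt) (auto simp: power2_eq_square)
      ultimately show ?thesis using A by (intro mult_left_mono) auto
    qed
    finally show ?thesis by simp
  qed
  have upper: "V w < 2 * A" if w: "dist \<xi> w \<le> \<rho>" for w
  proof (rule ccontr)
    assume "\<not> V w < 2 * A"
    define S where "S = {w. 2 * A \<le> V w}"
    have "closed S"
      unfolding S_def by (rule closed_Collect_le[OF continuous_on_const V])
    moreover have "w \<in> S" using \<open>\<not> V w < 2 * A\<close> by (simp add: S_def)
    \<comment> \<open>A point of \<open>S\<close> nearest to \<open>\<xi>\<close> is a first exit
      point: \<open>V\<close> stays below 2A in the open ball reaching up to it, so
      \<open>step\<close> forces V y \<le> 3A/2, contrary to \<open>y \<in> S\<close>.\<close>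
    ultimately obtain y where y: "y \<in> S" "\<And>w. w \<in> S \<Longrightarrow> dist \<xi> y \<le> dist \<xi> w"
      using distance_attains_inf[of S \<xi>] by blast
    have "y \<noteq> \<xi>" using y(1) A by (auto simp: S_def A_def)
    moreover have "V p \<le> 2 * A" if "p \<in> ball \<xi> (dist \<xi> y)" for p
      using y(2)[of p] that by (force simp: S_def)
    ultimately have "\<bar>V y - A\<bar> \<le> A / 2"
      using y(2)[OF \<open>w \<in> S\<close>] w by (intro step[of "dist \<xi> y" y]) auto
    then show False using y(1) A by (auto simp: S_def)
  qed
  have "\<bar>V x - A\<bar> \<le> A / 2"
    using near \<rho> by (intro step[of \<rho> x]) (auto simp: \<rho>_def A_def[symmetric] intro!: less_imp_le[OF upper])
  then show "V \<xi> / 2 \<le> V x" "V x \<le> 2 * V \<xi>"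
    using A unfolding A_def by linarith+
qed

section \<open>The Gagliardo--Nirenberg inequality in the plane\<close>

definition vec2 :: "real \<times> real \<Rightarrow> real^2" where
  "vec2 p = (\<chi> i. if i = 1 then fst p else snd p)"

lemma vec2_nth [simp]: "vec2 p $ 1 = fst p" "vec2 p $ 2 = snd p"
  by (simp_all add: vec2_def)

lemma continuous_on_vec2: "continuous_on S vec2"
  unfolding vec2_def
proof (rule continuous_on_vec_lambda)
  fix i :: 2
  show "continuous_on S (\<lambda>p. if i = 1 then fst p else snd p)"
    by (cases "i = 1") (auto intro: continuous_intros)
qed

text \<open>Lebesgue measure is determined by its values on boxes, and the preimage of a box under
  \<open>vec2\<close> is a product of intervals.\<close>

lemma lborel_vec2_eq_distr: "lborel = distr (lborel \<Otimes>\<^sub>M lborel) borel vec2"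
proof (rule lborel_eqI)
  have T: "vec2 \<in> borel_measurable (lborel \<Otimes>\<^sub>M lborel)"
    unfolding lborel_prod
    using borel_measurable_continuous_onI[OF continuous_on_vec2] by simp
  fix l u :: "real^2" assume le: "\<And>b. b \<in> Basis \<Longrightarrow> l \<bullet> b \<le> u \<bullet> b"
  have le': "l $ i \<le> u $ i" for i
    using le[of "axis i 1"] by (simp add: inner_axis axis_in_Basis_iff)
  have eq: "vec2 -` box l u = {l$1<..<u$1} \<times> {l$2<..<u$2}"
    by (auto simp: mem_box_cart forall_2)
  have B: "(Basis :: (real^2) set) = (\<lambda>i. axis i 1) ` UNIV"
    by (auto simp: Basis_vec_def)
  have "(\<Prod>b\<in>Basis. (u - l) \<bullet> b) = (u$1 - l$1) * (u$2 - l$2)"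
    unfolding B by (subst prod.reindex) (auto simp: inj_on_def axis_eq_axis inner_axis UNIV_2)
  with eq show "emeasure (distr (lborel \<Otimes>\<^sub>M lborel) borel vec2) (box l u) = ennreal (\<Prod>b\<in>Basis. (u - l) \<bullet> b)"
    using le' by (simp add: emeasure_distr[OF T] space_pair_measure lborel.emeasure_pair_measure_Times ennreal_mult)
qed simp

lemma nn_integral_vec2:
  assumes [measurable]: "f \<in> borel_measurable borel"
  shows "(\<integral>\<^sup>+x. f x \<partial>lborel) = (\<integral>\<^sup>+b. \<integral>\<^sup>+a. f (vec2 (a, b)) \<partial>lborel \<partial>lborel)" (is "_ = ?R1")
    and "(\<integral>\<^sup>+x. f x \<partial>lborel) = (\<integral>\<^sup>+a. \<integral>\<^sup>+b. f (vec2 (a, b)) \<partial>lborel \<partial>lborel)" (is "_ = ?R2")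
proof -
  have T[measurable]: "vec2 \<in> borel_measurable (lborel \<Otimes>\<^sub>M lborel)"
    unfolding lborel_prod
    using borel_measurable_continuous_onI[OF continuous_on_vec2] by simp
  have *: "(\<integral>\<^sup>+x. f x \<partial>lborel) = (\<integral>\<^sup>+p. f (vec2 p) \<partial>(lborel \<Otimes>\<^sub>M lborel))"
    by (subst lborel_vec2_eq_distr, subst nn_integral_distr) auto
  show "(\<integral>\<^sup>+x. f x \<partial>lborel) = ?R1"
    unfolding * by (rule lborel_pair.nn_integral_snd[symmetric]) measurable
  show "(\<integral>\<^sup>+x. f x \<partial>lborel) = ?R2"
    unfolding * by (rule lborel.nn_integral_fst[symmetric]) measurable
qed

text \<open>The fundamental theorem of calculus from a zero \<open>a\<close> of \<open>h\<close>;
  the bound lives in \<open>ennreal\<close> because the integral over the line may be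
  infinite.\<close>

lemma abs_le_nn_integral_derivative:
  fixes h h' :: "real \<Rightarrow> real"
  assumes der: "\<And>t. (h has_real_derivative h' t) (at t)" and cont: "continuous_on UNIV h'"
    and zero: "h a = 0" "a \<le> t"
  shows "ennreal \<bar>h t\<bar> \<le> (\<integral>\<^sup>+s. ennreal \<bar>h' s\<bar> \<partial>lborel)"
proof -
  have "integrable lborel (\<lambda>s. indicator {a..t} s *\<^sub>R h' s)"
    by (rule borel_integrable_compact) (auto intro: continuous_on_subset[OF cont])
  then have "ennreal (norm (\<integral>s. indicator {a..t} s *\<^sub>R h' s \<partial>lborel))
      \<le> (\<integral>\<^sup>+s. ennreal (norm (indicator {a..t} s *\<^sub>R h' s)) \<partial>lborel)"
    by (rule integral_norm_bound_ennreal)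
  moreover have "(\<integral>s. indicator {a..t} s *\<^sub>R h' s \<partial>lborel) = h t - h a"
    by (rule integral_FTC_atLeastAtMost[OF \<open>a \<le> t\<close>])
      (use der cont in \<open>auto simp: has_real_derivative_iff_has_vector_derivative[symmetric]
        intro: has_field_derivative_at_within continuous_on_subset\<close>)
  moreover have "(\<integral>\<^sup>+s. ennreal (norm (indicator {a..t} s *\<^sub>R h' s)) \<partial>lborel) \<le> (\<integral>\<^sup>+s. ennreal \<bar>h' s\<bar> \<partial>lborel)"
    by (intro nn_integral_mono) (auto simp: indicator_def)
  ultimately show ?thesis using zero by simp
qed

text \<open>At a point (a, b), |f| is at most the integral \<open>A b\<close> of
  |\<open>g 1\<close>| along the horizontal line and the integral \<open>B a\<close> of
  |\<open>g 2\<close>| along the vertical one. Multiplying gives f^2 \<le> \<open>A b * B a\<close>,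
  whose variables are separated, so Tonelli factors the double integral.\<close>

lemma gagliardo_nirenberg_plane:
  fixes f :: "real^2 \<Rightarrow> real" and g :: "2 \<Rightarrow> real^2 \<Rightarrow> real"
  assumes der: "\<And>x. (f has_derivative (\<lambda>v. \<Sum>i\<in>UNIV. v $ i * g i x)) (at x)"
    and cont: "\<And>i. continuous_on UNIV (g i)" and supp: "bounded {x. f x \<noteq> 0}"
  shows "(\<integral>\<^sup>+x. ennreal ((f x)\<^sup>2) \<partial>lborel)
    \<le> (\<integral>\<^sup>+x. ennreal \<bar>g 1 x\<bar> \<partial>lborel) * (\<integral>\<^sup>+x. ennreal \<bar>g 2 x\<bar> \<partial>lborel)"
proof -
  have contf: "continuous_on UNIV f"
    by (rule has_derivative_continuous_on[OF has_derivative_at_withinI[OF der]])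
  have [measurable]: "f \<in> borel_measurable borel" "g i \<in> borel_measurable borel" for i
    using contf cont by (auto intro: borel_measurable_continuous_onI)
  have T[measurable]: "vec2 \<in> borel_measurable (lborel \<Otimes>\<^sub>M lborel)"
    unfolding lborel_prod
    using borel_measurable_continuous_onI[OF continuous_on_vec2] by simp
  obtain L where L: "\<And>x. f x \<noteq> 0 \<Longrightarrow> norm x < L" 
    using supp by (auto simp: bounded_pos_less)
  have zero: "f x = 0" if "\<bar>x $ i\<bar> \<ge> L" for x i
    using L[of x] component_le_norm_cart[of x i] that by fastforce
  define A where "A b = (\<integral>\<^sup>+s. ennreal \<bar>g 1 (vec2 (s, b))\<bar> \<partial>lborel)" for b
  define B where "B a = (\<integral>\<^sup>+s. ennreal \<bar>g 2 (vec2 (a, s))\<bar> \<partial>lborel)" for a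
  have cont': "continuous_on UNIV (\<lambda>s. g i (vec2 (s, b)))" "continuous_on UNIV (\<lambda>s. g i (vec2 (a, s)))" for i a b
    by (auto intro!: continuous_on_compose2[OF cont] continuous_on_compose2[OF continuous_on_vec2] continuous_intros)
  have vd: "((\<lambda>s. vec2 (s, b)) has_derivative (\<lambda>h. vec2 (h, 0))) (at t)"
       "((\<lambda>s. vec2 (a, s)) has_derivative (\<lambda>h. vec2 (0, h))) (at t)" for a b t
  proof -
    have e: "vec2 (s, b) = s *\<^sub>R vec2 (1, 0) + vec2 (0, b)" "vec2 (a, s) = s *\<^sub>R vec2 (0, 1) + vec2 (a, 0)" for s a b
      by (auto simp: vec_eq_iff vec2_def)
    have z: "vec2 (0, 0) = 0" by (simp add: vec_eq_iff vec2_def)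
    show "((\<lambda>s. vec2 (s, b)) has_derivative (\<lambda>h. vec2 (h, 0))) (at t)"
      by (subst (1 2) e) (auto intro!: derivative_eq_intros simp: z)
    show "((\<lambda>s. vec2 (a, s)) has_derivative (\<lambda>h. vec2 (0, h))) (at t)"
      by (subst (1 2) e) (auto intro!: derivative_eq_intros simp: z)
  qed
  have d1: "((\<lambda>s. f (vec2 (s, b))) has_real_derivative g 1 (vec2 (t, b))) (at t)" for t b
    using has_derivative_compose[OF vd(1) der]
    by (simp add: has_field_derivative_def UNIV_2 mult_commute_abs)
  have d2: "((\<lambda>s. f (vec2 (a, s))) has_real_derivative g 2 (vec2 (a, t))) (at t)" for t a
    using has_derivative_compose[OF vd(2) der]
    by (simp add: has_field_derivative_def UNIV_2 mult_commute_abs)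
  have le: "ennreal ((f (vec2 (a, b)))\<^sup>2) \<le> A b * B a" for a b
  proof -
    \<comment> \<open>The base point of the line integral lies at or left of \<open>a\<close> and
      has size at least \<open>L\<close>, so \<open>f\<close> vanishes there.\<close>
    have "ennreal \<bar>f (vec2 (a, b))\<bar> \<le> A b"
      unfolding A_def
      by (rule abs_le_nn_integral_derivative[where h = "\<lambda>s. f (vec2 (s, b))" and a = "- \<bar>L\<bar> - \<bar>a\<bar>", OF d1 cont'(1)])
        (auto intro!: zero[of _ 1])
    moreover have "ennreal \<bar>f (vec2 (a, b))\<bar> \<le> B a"
      unfolding B_def
      by (rule abs_le_nn_integral_derivative[where h = "\<lambda>s. f (vec2 (a, s))" and a = "- \<bar>L\<bar> - \<bar>b\<bar>", OF d2 cont'(2)])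
        (auto intro!: zero[of _ 2])
    ultimately have "ennreal \<bar>f (vec2 (a, b))\<bar> * ennreal \<bar>f (vec2 (a, b))\<bar> \<le> A b * B a"
      by (rule mult_mono) auto
    then show ?thesis by (simp add: ennreal_mult[symmetric] power2_eq_square)
  qed
  have mA[measurable]: "A \<in> borel_measurable lborel"
  proof -
    have "(\<lambda>p. ennreal \<bar>g 1 (vec2 (snd p, fst p))\<bar>) \<in> borel_measurable (lborel \<Otimes>\<^sub>M lborel)"
      by measurable
    from lborel.borel_measurable_nn_integral_fst[OF this] show ?thesis
      by (simp add: A_def[abs_def])
  qed
  have mB[measurable]: "B \<in> borel_measurable lborel"
  proof -
    have "(\<lambda>p. ennreal \<bar>g 2 (vec2 p)\<bar>) \<in> borel_measurable (lborel \<Otimes>\<^sub>M lborel)"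
      by measurable
    from lborel.borel_measurable_nn_integral_fst[OF this] show ?thesis
      by (simp add: B_def[abs_def])
  qed
  have "(\<integral>\<^sup>+x. ennreal ((f x)\<^sup>2) \<partial>lborel) = (\<integral>\<^sup>+b. \<integral>\<^sup>+a. ennreal ((f (vec2 (a, b)))\<^sup>2) \<partial>lborel \<partial>lborel)"
    by (rule nn_integral_vec2) measurable
  also have "\<dots> \<le> (\<integral>\<^sup>+b. \<integral>\<^sup>+a. A b * B a \<partial>lborel \<partial>lborel)"
    by (intro nn_integral_mono le)
  also have "\<dots> = (\<integral>\<^sup>+b. A b \<partial>lborel) * (\<integral>\<^sup>+a. B a \<partial>lborel)"
    by (simp add: nn_integral_cmult nn_integral_multc)
  also have "(\<integral>\<^sup>+b. A b \<partial>lborel) = (\<integral>\<^sup>+x. ennreal \<bar>g 1 x\<bar> \<partial>lborel)"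
    unfolding A_def by (rule nn_integral_vec2(1)[symmetric]) measurable
  also have "(\<integral>\<^sup>+a. B a \<partial>lborel) = (\<integral>\<^sup>+x. ennreal \<bar>g 2 x\<bar> \<partial>lborel)"
    unfolding B_def by (rule nn_integral_vec2(2)[symmetric]) measurable
  finally show ?thesis .
qed

section \<open>Cutoff functions and auxiliary estimates\<close>

lemma max_sq_has_derivative:
  "((\<lambda>s::real. (max 0 s)\<^sup>2) has_real_derivative 2 * max 0 s) (at s)"
proof -
  consider "s < 0" | "s = 0" | "s > 0" by linarith
  then show ?thesis
  proof cases
    case 1
    have "((\<lambda>_. 0) has_real_derivative 0) (at s)" by simp
    then have "((\<lambda>s::real. (max 0 s)\<^sup>2) has_real_derivative 0) (at s)"
      by (rule has_field_derivative_transform_within_open[of _ _ _ "{..<0}"])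
        (use 1 in auto)
    then show ?thesis using 1 by simp
  next
    case 3
    have "((\<lambda>s. s\<^sup>2) has_real_derivative 2 * s) (at s)"
      by (auto intro!: derivative_eq_intros)
    then have "((\<lambda>s::real. (max 0 s)\<^sup>2) has_real_derivative 2 * s) (at s)"
      by (rule has_field_derivative_transform_within_open[of _ _ _ "{0<..}"])
        (use 3 in auto)
    then show ?thesis using 3 by simp
  next
    case 2
    have "((\<lambda>h::real. (max 0 h)\<^sup>2 / h) \<longlongrightarrow> 0) (at 0)"
    proof (rule Lim_null_comparison)
      show "\<forall>\<^sub>F h::real in at 0. norm ((max 0 h)\<^sup>2 / h) \<le> \<bar>h\<bar>"
        by (auto simp: eventually_at_filter max_def power2_eq_square)
      show "((\<lambda>h::real. \<bar>h\<bar>) \<longlongrightarrow> 0) (at 0)"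
        by (rule tendsto_rabs_zero) (rule tendsto_ident_at)
    qed
    then show ?thesis using 2 by (simp add: DERIV_def)
  qed
qed

text \<open>The outer square makes the positive part C^1, the regularity that
  \<open>gagliardo_nirenberg_plane\<close> asks for; the closed formula makes the cutoff jointly
  measurable in centre and point, as Tonelli over the centres demands.\<close>

definition cutoff :: "real \<Rightarrow> 'a::real_inner \<Rightarrow> 'a \<Rightarrow> real" where
  "cutoff R \<xi> x = (max 0 (1 - (norm (x - \<xi>))\<^sup>2 / R\<^sup>2))\<^sup>2"

definition cutoff_partial :: "real \<Rightarrow> real^2 \<Rightarrow> 2 \<Rightarrow> real^2 \<Rightarrow> real" where
  "cutoff_partial R \<xi> i x = - 4 * max 0 (1 - (norm (x - \<xi>))\<^sup>2 / R\<^sup>2) * (x - \<xi>) $ i / R\<^sup>2"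

lemma cutoff_has_derivative:
  fixes x \<xi> :: "real^2"
  shows "(cutoff R \<xi> has_derivative (\<lambda>v. \<Sum>i\<in>UNIV. v $ i * cutoff_partial R \<xi> i x)) (at x)"
proof -
  have "((\<lambda>x. 1 - ((x - \<xi>) \<bullet> (x - \<xi>)) / R\<^sup>2) has_derivative (\<lambda>v. - (2 * ((x - \<xi>) \<bullet> v)) / R\<^sup>2)) (at x)"
    unfolding divide_inverse by (auto intro!: derivative_eq_intros simp: inner_commute)
  from has_derivative_compose[OF this max_sq_has_derivative[unfolded has_field_derivative_def]]
  have *: "(cutoff R \<xi> has_derivative (\<lambda>v. 2 * max 0 (1 - ((x - \<xi>) \<bullet> (x - \<xi>)) / R\<^sup>2) * (- (2 * ((x - \<xi>) \<bullet> v)) / R\<^sup>2))) (at x)"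
    by (simp add: cutoff_def[abs_def] power2_norm_eq_inner)
  show ?thesis
    by (rule has_derivative_eq_rhs[OF *])
      (simp add: fun_eq_iff cutoff_partial_def power2_norm_eq_inner inner_vec_def[of _ "_::real^2"] UNIV_2 algebra_simps
        add_divide_distrib diff_divide_distrib)
qed

lemma continuous_on_cutoff_partial: "continuous_on S (cutoff_partial R \<xi> i)"
  unfolding cutoff_partial_def[abs_def] divide_inverse by (intro continuous_intros)

lemma cutoff_bounds: "0 \<le> cutoff R \<xi> x" "cutoff R \<xi> x \<le> 1"
  by (auto simp: cutoff_def intro!: power_le_one)

lemma one_minus_ratio_nonpos:
  assumes "R > 0" "x \<notin> ball \<xi> R"
  shows "1 - (norm (x - \<xi>))\<^sup>2 / R\<^sup>2 \<le> 0"
  using assms by (simp add: dist_norm norm_minus_commute power_mono)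

lemma cutoff_eq_0: "R > 0 \<Longrightarrow> x \<notin> ball \<xi> R \<Longrightarrow> cutoff R \<xi> x = 0"
  unfolding cutoff_def by (subst max_absorb1[OF one_minus_ratio_nonpos]) auto

lemma cutoff_partial_eq_0: "R > 0 \<Longrightarrow> x \<notin> ball \<xi> R \<Longrightarrow> cutoff_partial R \<xi> i x = 0"
  unfolding cutoff_partial_def by (subst max_absorb1[OF one_minus_ratio_nonpos]) auto

lemma cutoff_partial_bound:
  assumes "R > 0"
  shows "\<bar>cutoff_partial R \<xi> i x\<bar> \<le> 4 / R"
proof (cases "x \<in> ball \<xi> R")
  case True
  have "\<bar>(x - \<xi>) $ i\<bar> \<le> R"
    using True component_le_norm_cart[of "x - \<xi>" i] by (simp add: dist_norm norm_minus_commute)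
  moreover have "\<bar>max 0 (1 - (norm (x - \<xi>))\<^sup>2 / R\<^sup>2)\<bar> \<le> 1" by auto
  ultimately have "\<bar>max 0 (1 - (norm (x - \<xi>))\<^sup>2 / R\<^sup>2)\<bar> * \<bar>(x - \<xi>) $ i\<bar> \<le> 1 * R"
    by (intro mult_mono) auto
  then have "4 * (\<bar>max 0 (1 - (norm (x - \<xi>))\<^sup>2 / R\<^sup>2)\<bar> * \<bar>(x - \<xi>) $ i\<bar>) / R\<^sup>2 \<le> 4 * (1 * R) / R\<^sup>2"
    by (intro divide_right_mono mult_left_mono) auto
  then show ?thesis
    using assms by (simp add: cutoff_partial_def abs_mult power2_eq_square mult.assoc)
qed (use assms cutoff_partial_eq_0 in auto)

text \<open>Within half the radius the positive part is at least 3/4, and (3/4)^4 = 81/256 exceeds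
  1/4.\<close>

lemma cutoff_ge:
  assumes "dist x \<xi> \<le> R / 2" "R > 0"
  shows "1 / 4 \<le> (cutoff R \<xi> x)\<^sup>2"
proof -
  have "(norm (x - \<xi>))\<^sup>2 / R\<^sup>2 \<le> (R / 2)\<^sup>2 / R\<^sup>2"
    using assms by (intro divide_right_mono power_mono) (auto simp: dist_norm)
  also have "\<dots> = 1 / 4" using assms by (simp add: power_divide)
  finally have "3 / 4 \<le> max 0 (1 - (norm (x - \<xi>))\<^sup>2 / R\<^sup>2)"
    unfolding le_max_iff_disj by linarith
  then have "(3 / 4)\<^sup>2 \<le> cutoff R \<xi> x" unfolding cutoff_def by (rule power_mono) simp
  then have "((3 / 4)\<^sup>2)\<^sup>2 \<le> (cutoff R \<xi> x)\<^sup>2" by (rule power_mono) simp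
  then show ?thesis by (simp add: power_divide)
qed

section \<open>Measure of balls, almost everywhere convergence and a quadratic bound\<close>

lemma emeasure_ball_plane:
  "r \<ge> 0 \<Longrightarrow> emeasure lborel (ball (x::real^2) r) = ennreal (pi * r\<^sup>2)"
  by (simp add: emeasure_ball unit_ball_vol_2)

lemma ball_measurable [measurable]: "ball x r \<in> sets borel"
  by simp

text \<open>Prepares Fatou's lemma: the weighted squares tend to 0 in L^1, hence almost everywhere
  along a subsequence, and dividing by \<open>V x > 0\<close> gives pointwise convergence.\<close>

lemma AE_subseq_of_weighted_L2:
  fixes \<phi> :: "nat \<Rightarrow> 'a::euclidean_space \<Rightarrow> real"
  assumes [measurable]: "V \<in> borel_measurable borel" "u \<in> borel_measurable borel" "\<And>k. \<phi> k \<in> borel_measurable borel"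
    and Vpos: "\<And>x. V x > 0"
    and lim: "(\<lambda>k. \<integral>\<^sup>+ x. ennreal (V x * (\<phi> k x - u x)^2) \<partial>lborel) \<longlonglongrightarrow> 0"
  obtains s :: "nat \<Rightarrow> nat" where "strict_mono s" "AE x in lborel. (\<lambda>k. \<phi> (s k) x) \<longlonglongrightarrow> u x"
proof -
  \<comment> \<open>Convergence in \<open>ennreal\<close> allows finitely many infinite terms;
    shifting the index by \<open>N\<close> leaves integrable functions.\<close>
  have "eventually (\<lambda>k. (\<integral>\<^sup>+ x. ennreal (V x * (\<phi> k x - u x)^2) \<partial>lborel) < \<infinity>) sequentially"
    using order_tendstoD(2)[OF lim, of \<infinity>] by simp
  then obtain N where N: "\<And>k. k \<ge> N \<Longrightarrow> (\<integral>\<^sup>+ x. ennreal (V x * (\<phi> k x - u x)^2) \<partial>lborel) < \<infinity>"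
    by (auto simp: eventually_sequentially)
  define w where "w k x = V x * (\<phi> (k + N) x - u x)^2" for k x
  have w0: "w k x \<ge> 0" for k x using Vpos[of x] by (simp add: w_def)
  have [measurable]: "w k \<in> borel_measurable borel" for k unfolding w_def[abs_def] by measurable
  have int: "integrable lborel (w k)" for k
    using N[of "k + N"] w0 by (intro integrableI_nonneg) (auto simp: w_def[abs_def])
  have "(\<lambda>k. \<integral>x. norm (w k x) \<partial>lborel) \<longlonglongrightarrow> 0"
  proof -
    have "(\<lambda>k. \<integral>\<^sup>+ x. ennreal (w k x) \<partial>lborel) \<longlonglongrightarrow> ennreal 0"
      unfolding w_def using LIMSEQ_ignore_initial_segment[OF lim, of N] by simp
    then have "(\<lambda>k. enn2real (\<integral>\<^sup>+ x. ennreal (w k x) \<partial>lborel)) \<longlonglongrightarrow> 0"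
      by (rule tendsto_enn2real) simp
    then show ?thesis using w0 by (simp add: integral_eq_nn_integral)
  qed
  from tendsto_L1_AE_subseq[OF int this] obtain s where s: "strict_mono s"
    "AE x in lborel. (\<lambda>k. w (s k) x) \<longlonglongrightarrow> 0" by blast
  show ?thesis
  proof
    show "strict_mono (\<lambda>k. s k + N)" using s(1) by (auto simp: strict_mono_def)
    show "AE x in lborel. (\<lambda>k. \<phi> (s k + N) x) \<longlonglongrightarrow> u x"
      using s(2)
    proof eventually_elim
      case (elim x)
      then have "(\<lambda>k. w (s k) x / V x) \<longlonglongrightarrow> 0 / V x"
        using Vpos[of x] by (intro tendsto_divide) auto
      then have "(\<lambda>k. (\<phi> (s k + N) x - u x)^2) \<longlonglongrightarrow> 0"
        using Vpos[of x] by (simp add: w_def)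
      then have "(\<lambda>k. sqrt ((\<phi> (s k + N) x - u x)^2)) \<longlonglongrightarrow> sqrt 0"
        by (rule tendsto_real_sqrt)
      then have "(\<lambda>k. \<phi> (s k + N) x - u x) \<longlonglongrightarrow> 0"
        by (simp add: tendsto_rabs_zero_iff)
      then show ?case by (simp add: LIM_zero_iff)
    qed
  qed
qed

lemma square_le_double:
  fixes a b :: "'a::real_normed_vector"
  shows "(norm a)\<^sup>2 \<le> 2 * (norm b)\<^sup>2 + 2 * (norm (a - b))\<^sup>2"
proof -
  have "norm a \<le> norm b + norm (a - b)" using norm_triangle_sub by blast
  then have "(norm a)\<^sup>2 \<le> (norm b + norm (a - b))\<^sup>2" by (rule power_mono) simp
  also have "\<dots> \<le> 2 * (norm b)\<^sup>2 + 2 * (norm (a - b))\<^sup>2"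
    using sum_squares_bound[of "norm b" "norm (a - b)"] by (simp only: power2_sum)
  finally show ?thesis .
qed

section \<open>Weights comparable to constants at the scale of their inverse square root\<close>

text \<open>The estimates below see the gradient condition through this comparability alone. At the
  radius \<open>\<rho> / sqrt (V \<xi>)\<close> the weight times the squared radius is the constant
  \<open>\<rho>\<^sup>2\<close>, so potential and gradient terms scale alike.\<close>

locale comparable_weight =
  fixes V :: "real^2 \<Rightarrow> real" and \<rho> :: real
  assumes V_cont: "continuous_on UNIV V" and V_pos: "V x > 0" and \<rho>_pos: "\<rho> > 0"
    and comparable: "dist \<xi> x \<le> \<rho> / sqrt (V \<xi>) \<Longrightarrow> V \<xi> \<le> 2 * V x \<and> V x \<le> 2 * V \<xi>"
begin

definition rad :: "real^2 \<Rightarrow> real" where "rad \<xi> = \<rho> / sqrt (V \<xi>)"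

definition energy :: "(real^2 \<Rightarrow> real) \<Rightarrow> real^2 \<Rightarrow> real" where
  "energy \<phi> x = (norm (grad \<phi> x))\<^sup>2 + V x * (\<phi> x)\<^sup>2"

lemma rad_pos: "rad \<xi> > 0"
  using V_pos \<rho>_pos by (simp add: rad_def)

lemma rad_sq: "(rad \<xi>)\<^sup>2 = \<rho>\<^sup>2 / V \<xi>"
  using V_pos[of \<xi>] by (simp add: rad_def power_divide)

lemma V_measurable [measurable]: "V \<in> borel_measurable borel"
  by (rule borel_measurable_continuous_onI[OF V_cont])

lemma rad_measurable [measurable]: "rad \<in> borel_measurable borel"
  unfolding rad_def[abs_def] by measurable

lemma energy_nonneg: "energy \<phi> x \<ge> 0"
  using V_pos[of x] by (simp add: energy_def)

lemma test_fun_measurable: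
  assumes "test_fun \<phi>"
  shows "\<phi> \<in> borel_measurable borel" "grad \<phi> \<in> borel_measurable borel" "energy \<phi> \<in> borel_measurable borel"
proof -
  have s: "smooth2 \<phi>" using assms by (simp add: test_fun_def)
  show [measurable]: "\<phi> \<in> borel_measurable borel"
    by (rule borel_measurable_continuous_onI[OF smooth2_continuous_on[OF s]])
  show [measurable]: "grad \<phi> \<in> borel_measurable borel"
    unfolding grad_def[abs_def]
    by (intro borel_measurable_continuous_onI continuous_on_vec_lambda smooth2_continuous_on smooth2_partial s)
  show "energy \<phi> \<in> borel_measurable borel"
    unfolding energy_def[abs_def] by measurable
qed

text \<open>Of the two factors \<open>V \<xi>\<close> on the left, one is absorbed into the integral
  of the power 2k at the cost of a factor 2, and the other stays with the energy until it is
  integrated in \<open>\<xi>\<close>. In \<open>D\<close> the term 64/\<rho>^2 stems from the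
  gradient of the cutoff, as 2 (4/R)^2 = 32 V \<xi>/\<rho>^2 \<le> 64 V x/\<rho>^2 on the ball, and
  2 (k+1)^2 from differentiating \<open>\<phi> x ^ Suc k\<close>.\<close>

lemma local_inequality:
  assumes \<phi>: "test_fun \<phi>"
    and S: "(\<integral>\<^sup>+x\<in>ball \<xi> (rad \<xi>). ennreal (V x * \<phi> x ^ (2 * k)) \<partial>lborel) \<le> S"
  defines "D \<equiv> 64 / \<rho>\<^sup>2 + 2 * (real (Suc k))\<^sup>2"
  shows "(\<integral>\<^sup>+x. ennreal ((V \<xi>)\<^sup>2 * (cutoff (rad \<xi>) \<xi> x)\<^sup>2 * \<phi> x ^ (2 * Suc k)) \<partial>lborel)
    \<le> ennreal (2 * D) * S * (\<integral>\<^sup>+x\<in>ball \<xi> (rad \<xi>). ennreal (V \<xi> * energy \<phi> x) \<partial>lborel)"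
proof -
  note [measurable] = test_fun_measurable[OF \<phi>]
  have sm: "smooth2 \<phi>" using \<phi> by (simp add: test_fun_def)
  have D: "D \<ge> 0" by (simp add: D_def)
  define R where "R = rad \<xi>"
  have R: "R > 0" using rad_pos by (simp add: R_def)
  \<comment> \<open>Being idempotent, \<open>I\<close> localises both factors of the Cauchy-Schwarz
    product at once.\<close>
  define I where "I = (indicator (ball \<xi> R) :: real^2 \<Rightarrow> real)"
  have [measurable]: "I \<in> borel_measurable borel"
    unfolding I_def by (rule borel_measurable_indicator) simp
  have I: "I x = 0 \<or> I x = 1" for x by (simp add: I_def indicator_def)
  define f where "f x = cutoff R \<xi> x * \<phi> x ^ Suc k" for x
  define g where "g i x = cutoff R \<xi> x * (real (Suc k) * \<phi> x ^ k * partial \<phi> i x)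
      + cutoff_partial R \<xi> i x * \<phi> x ^ Suc k" for i x
  \<comment> \<open>What remains of the bound on |\<open>g i\<close>| once the power |\<phi>|^k is
    split off; it serves both coordinates.\<close>
  define h where "h x = 4 / R * \<bar>\<phi> x\<bar> + real (Suc k) * norm (grad \<phi> x)" for x
  have h0: "h x \<ge> 0" for x using R by (simp add: h_def)
  have [measurable]: "h \<in> borel_measurable borel" unfolding h_def[abs_def] by measurable
  have der: "(f has_derivative (\<lambda>v. \<Sum>i\<in>UNIV. v $ i * g i x)) (at x)" for x
  proof -
    have "((\<lambda>x. \<phi> x ^ Suc k) has_derivative
        (\<lambda>v. real (Suc k) * (\<Sum>i\<in>UNIV. v $ i * partial \<phi> i x) * \<phi> x ^ k)) (at x)"
      using has_derivative_power[OF smooth2_has_derivative[OF sm], where n = "Suc k"]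
      by (simp add: mult.commute mult.left_commute)
    from has_derivative_mult[OF cutoff_has_derivative this]
    show ?thesis
      unfolding f_def[abs_def] g_def
      by (rule has_derivative_eq_rhs) (simp add: fun_eq_iff UNIV_2 algebra_simps)
  qed
  have cont: "continuous_on UNIV (g i)" for i
  proof -
    have c: "continuous_on UNIV (cutoff R \<xi>)"
      by (rule has_derivative_continuous_on[OF has_derivative_at_withinI[OF cutoff_has_derivative]])
    show ?thesis
      unfolding g_def[abs_def]
      by (intro continuous_intros c continuous_on_cutoff_partial smooth2_continuous_on smooth2_partial sm)
  qed
  have "bounded {x. f x \<noteq> 0}"
    by (rule bounded_subset[OF bounded_ball[of \<xi> R]]) (use cutoff_eq_0[OF R, of _ \<xi>] in \<open>force simp: f_def\<close>)
  from gagliardo_nirenberg_plane[OF der cont this]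
  have gn: "(\<integral>\<^sup>+x. ennreal ((f x)\<^sup>2) \<partial>lborel)
    \<le> (\<integral>\<^sup>+x. ennreal \<bar>g 1 x\<bar> \<partial>lborel) * (\<integral>\<^sup>+x. ennreal \<bar>g 2 x\<bar> \<partial>lborel)" .
  define T where "T = (\<integral>\<^sup>+x. ennreal (I x * \<bar>\<phi> x\<bar> ^ k) * ennreal (I x * h x) \<partial>lborel)"
  have gT: "(\<integral>\<^sup>+x. ennreal \<bar>g i x\<bar> \<partial>lborel) \<le> T" for i
    unfolding T_def
  proof (rule nn_integral_mono)
    fix x
    have "\<bar>g i x\<bar> \<le> (I x * \<bar>\<phi> x\<bar> ^ k) * (I x * h x)"
    proof (cases "x \<in> ball \<xi> R")
      case True
      have "\<bar>g i x\<bar> \<le> cutoff R \<xi> x * (real (Suc k) * \<bar>\<phi> x\<bar> ^ k * \<bar>partial \<phi> i x\<bar>)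
          + \<bar>cutoff_partial R \<xi> i x\<bar> * \<bar>\<phi> x\<bar> ^ Suc k"
        unfolding g_def using cutoff_bounds(1)[of R \<xi> x]
        by (intro order_trans[OF abs_triangle_ineq]) (simp add: abs_mult power_abs)
      also have "\<dots> \<le> 1 * (real (Suc k) * \<bar>\<phi> x\<bar> ^ k * norm (grad \<phi> x)) + 4 / R * \<bar>\<phi> x\<bar> ^ Suc k"
        using component_le_norm_cart[of "grad \<phi> x" i] R
        by (intro add_mono mult_mono cutoff_bounds cutoff_partial_bound R) (auto simp: grad_def)
      also have "\<dots> = \<bar>\<phi> x\<bar> ^ k * h x" by (simp add: h_def algebra_simps)
      finally show ?thesis using True by (simp add: I_def)
    next
      case False
      then show ?thesis using cutoff_eq_0[OF R False] cutoff_partial_eq_0[OF R False]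
        by (simp add: g_def I_def)
    qed
    then show "ennreal \<bar>g i x\<bar> \<le> ennreal (I x * \<bar>\<phi> x\<bar> ^ k) * ennreal (I x * h x)"
      using I[of x] h0[of x] by (subst ennreal_mult[symmetric]) (auto intro: ennreal_leI)
  qed
  define E where "E = (\<integral>\<^sup>+x\<in>ball \<xi> R. ennreal (energy \<phi> x) \<partial>lborel)"
  define P where "P = (\<integral>\<^sup>+x. ennreal (I x * \<phi> x ^ (2 * k)) \<partial>lborel)"
  have IV: "V \<xi> \<le> 2 * V x" if "I x \<noteq> 0" for x
    using that comparable[of \<xi> x] by (auto simp: I_def R_def rad_def indicator_def split: if_splits)
  have "(\<integral>\<^sup>+x. ennreal ((f x)\<^sup>2) \<partial>lborel) \<le> T * T"
    by (rule order_trans[OF gn]) (intro mult_mono gT, auto)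
  also have "\<dots> \<le> (\<integral>\<^sup>+x. ennreal (I x * \<bar>\<phi> x\<bar> ^ k) ^ 2 \<partial>lborel) * (\<integral>\<^sup>+x. ennreal (I x * h x) ^ 2 \<partial>lborel)"
    unfolding T_def power2_eq_square[symmetric] by (rule Cauchy_Schwarz_nn_integral) measurable
  also have "(\<integral>\<^sup>+x. ennreal (I x * \<bar>\<phi> x\<bar> ^ k) ^ 2 \<partial>lborel) = P"
    unfolding P_def
  proof (rule nn_integral_cong)
    fix x show "ennreal (I x * \<bar>\<phi> x\<bar> ^ k) ^ 2 = ennreal (I x * \<phi> x ^ (2 * k))"
      using I[of x] by (auto simp: ennreal_power power_mult[symmetric] power_even_abs mult.commute)
  qed
  also have "(\<integral>\<^sup>+x. ennreal (I x * h x) ^ 2 \<partial>lborel) \<le> (\<integral>\<^sup>+x. ennreal D * (ennreal (energy \<phi> x) * indicator (ball \<xi> R) x) \<partial>lborel)"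
  proof (rule nn_integral_mono)
    fix x
    show "ennreal (I x * h x) ^ 2 \<le> ennreal D * (ennreal (energy \<phi> x) * indicator (ball \<xi> R) x)"
    proof (cases "x \<in> ball \<xi> R")
      case True
      have "(h x)\<^sup>2 \<le> 2 * (4 / R * \<bar>\<phi> x\<bar>)\<^sup>2 + 2 * (real (Suc k) * norm (grad \<phi> x))\<^sup>2"
        unfolding h_def using sum_squares_bound[of "4 / R * \<bar>\<phi> x\<bar>" "real (Suc k) * norm (grad \<phi> x)"]
        by (simp only: power2_sum)
      also have "(4 / R * \<bar>\<phi> x\<bar>)\<^sup>2 = 16 / \<rho>\<^sup>2 * (V \<xi> * (\<phi> x)\<^sup>2)"
        using rad_sq[of \<xi>] by (simp add: R_def power_mult_distrib power_divide)
      also have "2 * (16 / \<rho>\<^sup>2 * (V \<xi> * (\<phi> x)\<^sup>2)) \<le> 2 * (16 / \<rho>\<^sup>2 * ((2 * V x) * (\<phi> x)\<^sup>2))"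
        using IV[of x] True by (intro mult_left_mono mult_right_mono) (auto simp: I_def)
      also have "2 * (16 / \<rho>\<^sup>2 * ((2 * V x) * (\<phi> x)\<^sup>2)) = 64 / \<rho>\<^sup>2 * (V x * (\<phi> x)\<^sup>2)" by simp
      also have "\<dots> \<le> D * (V x * (\<phi> x)\<^sup>2)"
        using V_pos[of x] by (intro mult_right_mono) (auto simp: D_def)
      also have "2 * (real (Suc k) * norm (grad \<phi> x))\<^sup>2 = (2 * (real (Suc k))\<^sup>2) * (norm (grad \<phi> x))\<^sup>2"
        by (simp only: power_mult_distrib mult.assoc)
      also have "\<dots> \<le> D * (norm (grad \<phi> x))\<^sup>2"
        by (intro mult_right_mono) (auto simp: D_def)
      finally have "(h x)\<^sup>2 \<le> D * energy \<phi> x" by (simp add: energy_def algebra_simps)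
      then show ?thesis
        using True h0[of x] energy_nonneg[of \<phi> x] D
        by (simp add: I_def ennreal_power ennreal_mult[symmetric] ennreal_leI)
    qed (simp add: I_def)
  qed
  also have "\<dots> = ennreal D * E" unfolding E_def by (rule nn_integral_cmult) measurable
  finally have main: "(\<integral>\<^sup>+x. ennreal ((f x)\<^sup>2) \<partial>lborel) \<le> P * (ennreal D * E)"
    by this (auto intro: mult_left_mono)
  have "ennreal (V \<xi>) * P = (\<integral>\<^sup>+x. ennreal (V \<xi> * (I x * \<phi> x ^ (2 * k))) \<partial>lborel)"
    unfolding P_def using V_pos[of \<xi>] I
    by (subst nn_integral_cmult[symmetric]) (auto simp: ennreal_mult' intro!: nn_integral_cong)
  also have "\<dots> \<le> (\<integral>\<^sup>+x. ennreal 2 * (ennreal (V x * \<phi> x ^ (2 * k)) * indicator (ball \<xi> R) x) \<partial>lborel)"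
  proof (rule nn_integral_mono)
    fix x
    show "ennreal (V \<xi> * (I x * \<phi> x ^ (2 * k))) \<le> ennreal 2 * (ennreal (V x * \<phi> x ^ (2 * k)) * indicator (ball \<xi> R) x)"
    proof (cases "x \<in> ball \<xi> R")
      case True
      then have "V \<xi> * \<phi> x ^ (2 * k) \<le> 2 * V x * \<phi> x ^ (2 * k)"
        using IV[of x] by (intro mult_right_mono) (auto simp: I_def)
      then show ?thesis using True V_pos[of x]
        by (simp add: I_def ennreal_mult'[symmetric] ennreal_leI mult.assoc del: ennreal_numeral)
    qed (simp add: I_def)
  qed
  also have "\<dots> \<le> ennreal 2 * S"
    using S by (subst nn_integral_cmult) (auto simp: R_def intro!: mult_left_mono)
  finally have VP: "ennreal (V \<xi>) * P \<le> ennreal 2 * S" .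
  have "(\<integral>\<^sup>+x. ennreal ((V \<xi>)\<^sup>2 * (cutoff (rad \<xi>) \<xi> x)\<^sup>2 * \<phi> x ^ (2 * Suc k)) \<partial>lborel)
      = (\<integral>\<^sup>+x. ennreal (V \<xi>) * ennreal (V \<xi>) * ennreal ((f x)\<^sup>2) \<partial>lborel)"
  proof (rule nn_integral_cong)
    fix x
    have "(f x)\<^sup>2 = (cutoff (rad \<xi>) \<xi> x)\<^sup>2 * \<phi> x ^ (2 * Suc k)"
      unfolding f_def R_def power_mult_distrib power_mult[symmetric] by (simp add: mult.commute)
    then show "ennreal ((V \<xi>)\<^sup>2 * (cutoff (rad \<xi>) \<xi> x)\<^sup>2 * \<phi> x ^ (2 * Suc k))
        = ennreal (V \<xi>) * ennreal (V \<xi>) * ennreal ((f x)\<^sup>2)"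
      using V_pos[of \<xi>] by (simp add: ennreal_mult'[symmetric] ennreal_mult[symmetric] power2_eq_square mult.assoc)
  qed
  also have "\<dots> = ennreal (V \<xi>) * ennreal (V \<xi>) * (\<integral>\<^sup>+x. ennreal ((f x)\<^sup>2) \<partial>lborel)"
  proof (rule nn_integral_cmult)
    have "continuous_on UNIV f"
      by (rule has_derivative_continuous_on[OF has_derivative_at_withinI[OF der]])
    then have [measurable]: "f \<in> borel_measurable borel" by (rule borel_measurable_continuous_onI)
    show "(\<lambda>x. ennreal ((f x)\<^sup>2)) \<in> borel_measurable lborel" by measurable
  qed
  also have "\<dots> \<le> ennreal (V \<xi>) * ennreal (V \<xi>) * (P * (ennreal D * E))"
    by (intro mult_left_mono main) auto
  also have "\<dots> = (ennreal (V \<xi>) * P) * (ennreal D * (ennreal (V \<xi>) * E))"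
    by (simp add: ac_simps)
  also have "\<dots> \<le> (ennreal 2 * S) * (ennreal D * (ennreal (V \<xi>) * E))"
    by (intro mult_right_mono VP) auto
  also have "\<dots> = ennreal (2 * D) * S * (ennreal (V \<xi>) * E)"
    using D by (simp add: ennreal_mult ac_simps)
  also have "ennreal (V \<xi>) * E = (\<integral>\<^sup>+x\<in>ball \<xi> (rad \<xi>). ennreal (V \<xi> * energy \<phi> x) \<partial>lborel)"
    unfolding E_def R_def using V_pos[of \<xi>] energy_nonneg
    by (subst nn_integral_cmult[symmetric]) (auto simp: ennreal_mult mult.assoc intro!: nn_integral_cong)
  finally show ?thesis .
qed

section \<open>Averaging over the centres of the balls\<close>

lemma rad_le:
  assumes "V x \<le> 4 * V y"
  shows "rad y \<le> 2 * rad x"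
proof -
  have "sqrt (V x) \<le> sqrt (4 * V y)" using assms by (rule real_sqrt_le_mono)
  then have "sqrt (V x) \<le> 2 * sqrt (V y)" by (simp add: real_sqrt_mult)
  then have "\<rho> * sqrt (V x) \<le> \<rho> * (2 * sqrt (V y))" using \<rho>_pos by (intro mult_left_mono) auto
  then show ?thesis using V_pos[of x] V_pos[of y] by (simp add: rad_def field_simps)
qed

text \<open>For \<open>\<xi>\<close> within \<open>rad x / 4\<close> of \<open>x\<close>, V \<xi>
  \<ge> V x / 2 and \<open>x\<close> lies within half of \<open>rad \<xi>\<close>, so the integrand
  is at least (V x)^2/16; the area \<pi> \<rho>^2/(16 V x) of that small ball gives the
  constant.\<close>

lemma cutoff_average_lower:
  "ennreal (pi * \<rho>\<^sup>2 / 256 * V x) \<le> (\<integral>\<^sup>+\<xi>. ennreal ((V \<xi>)\<^sup>2 * (cutoff (rad \<xi>) \<xi> x)\<^sup>2) \<partial>lborel)"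
proof -
  have "ennreal (pi * \<rho>\<^sup>2 / 256 * V x) = ennreal ((V x)\<^sup>2 / 16) * emeasure lborel (ball x (rad x / 4))"
    using rad_pos[of x] V_pos[of x]
    by (simp add: emeasure_ball_plane power_divide rad_sq ennreal_mult[symmetric])
      (simp add: power2_eq_square)
  also have "\<dots> = (\<integral>\<^sup>+\<xi>. ennreal ((V x)\<^sup>2 / 16) * indicator (ball x (rad x / 4)) \<xi> \<partial>lborel)"
    by (simp add: nn_integral_cmult_indicator)
  also have "\<dots> \<le> (\<integral>\<^sup>+\<xi>. ennreal ((V \<xi>)\<^sup>2 * (cutoff (rad \<xi>) \<xi> x)\<^sup>2) \<partial>lborel)"
  proof (rule nn_integral_mono)
    fix \<xi>
    show "ennreal ((V x)\<^sup>2 / 16) * indicator (ball x (rad x / 4)) \<xi> \<le> ennreal ((V \<xi>)\<^sup>2 * (cutoff (rad \<xi>) \<xi> x)\<^sup>2)"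
    proof (cases "\<xi> \<in> ball x (rad x / 4)")
      case True
      then have d: "dist x \<xi> \<le> rad x / 4" by simp
      then have cmp: "V x \<le> 2 * V \<xi>" "V \<xi> \<le> 2 * V x"
        using comparable[of x \<xi>] rad_pos[of x] unfolding rad_def[symmetric] by auto
      have "dist x \<xi> \<le> rad \<xi> / 2"
        using d rad_le[of \<xi> x] cmp V_pos[of x] by simp
      then have c: "1 / 4 \<le> (cutoff (rad \<xi>) \<xi> x)\<^sup>2"
        by (rule cutoff_ge) (rule rad_pos)
      have "(V x / 2)\<^sup>2 * (1 / 4) \<le> (V \<xi>)\<^sup>2 * (cutoff (rad \<xi>) \<xi> x)\<^sup>2"
        using cmp V_pos[of x] by (intro mult_mono c power_mono) auto
      then show ?thesis using True by (simp add: power_divide ennreal_leI)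
    qed simp
  qed
  finally show ?thesis .
qed

text \<open>Takes the place of an overlap count: if \<open>ball \<xi> (rad \<xi>)\<close> contains
  \<open>x\<close>, then V \<xi> \<le> 2 V x and \<open>\<xi>\<close> is within
  \<open>2 * rad x\<close> of \<open>x\<close>; 2 V x times the area 4 \<pi> \<rho>^2 / V x is the
  constant.\<close>

lemma ball_average_upper:
  "(\<integral>\<^sup>+\<xi>. ennreal (V \<xi>) * indicator (ball \<xi> (rad \<xi>)) x \<partial>lborel) \<le> ennreal (8 * pi * \<rho>\<^sup>2)"
proof -
  have "(\<integral>\<^sup>+\<xi>. ennreal (V \<xi>) * indicator (ball \<xi> (rad \<xi>)) x \<partial>lborel)
      \<le> (\<integral>\<^sup>+\<xi>. ennreal (2 * V x) * indicator (ball x (2 * rad x)) \<xi> \<partial>lborel)"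
  proof (rule nn_integral_mono)
    fix \<xi>
    show "ennreal (V \<xi>) * indicator (ball \<xi> (rad \<xi>)) x \<le> ennreal (2 * V x) * indicator (ball x (2 * rad x)) \<xi>"
    proof (cases "x \<in> ball \<xi> (rad \<xi>)")
      case True
      then have cmp: "V \<xi> \<le> 2 * V x" "V x \<le> 2 * V \<xi>"
        using comparable[of \<xi> x] unfolding rad_def[symmetric] by auto
      have "\<xi> \<in> ball x (2 * rad x)"
        using True rad_le[of x \<xi>] cmp V_pos[of \<xi>] by (simp add: dist_commute)
      then show ?thesis using True cmp by (simp add: ennreal_leI del: mem_ball)
    qed simp
  qed
  also have "\<dots> = ennreal (2 * V x) * emeasure lborel (ball x (2 * rad x))"
    by (simp add: nn_integral_cmult_indicator)
  also have "\<dots> = ennreal (8 * pi * \<rho>\<^sup>2)"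
    using rad_pos[of x] V_pos[of x]
    by (simp add: emeasure_ball_plane power_mult_distrib rad_sq ennreal_mult[symmetric])
  finally show ?thesis .
qed

text \<open>\<open>cutoff_average_lower\<close> creates an integral over centres, Tonelli brings
  \<open>local_inequality\<close> under it, and a second use of Tonelli lets
  \<open>ball_average_upper\<close> integrate the centres out. \<open>K\<close> is chosen before
  \<open>\<phi>\<close> and \<open>S\<close>, so it is uniform along sequences.\<close>

lemma global_inequality:
  "\<exists>K\<ge>0. \<forall>\<phi> S. test_fun \<phi> \<longrightarrow>
     (\<forall>\<xi>. (\<integral>\<^sup>+x\<in>ball \<xi> (rad \<xi>). ennreal (V x * \<phi> x ^ (2 * k)) \<partial>lborel) \<le> S) \<longrightarrow>
     (\<integral>\<^sup>+x. ennreal (V x * \<phi> x ^ (2 * Suc k)) \<partial>lborel)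
       \<le> ennreal K * S * (\<integral>\<^sup>+x. ennreal (energy \<phi> x) \<partial>lborel)"
proof -
  define D where "D = 64 / \<rho>\<^sup>2 + 2 * (real (Suc k))\<^sup>2"
  have D: "D \<ge> 0" by (simp add: D_def)
  define c where "c = pi * \<rho>\<^sup>2 / 256"
  have c: "c > 0" using \<rho>_pos by (simp add: c_def)
  \<comment> \<open>The local constant 2D times the upper averaging constant, divided by the lower
    one \<open>c\<close>; this equals 4096 D.\<close>
  define K where "K = 1 / c * (2 * D * (8 * pi * \<rho>\<^sup>2))"
  have "(\<integral>\<^sup>+x. ennreal (V x * \<phi> x ^ (2 * Suc k)) \<partial>lborel)
       \<le> ennreal K * S * (\<integral>\<^sup>+x. ennreal (energy \<phi> x) \<partial>lborel)"
    if \<phi>: "test_fun \<phi>"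
      and S: "\<And>\<xi>. (\<integral>\<^sup>+x\<in>ball \<xi> (rad \<xi>). ennreal (V x * \<phi> x ^ (2 * k)) \<partial>lborel) \<le> S" for \<phi> S
  proof -
    note [measurable] = test_fun_measurable[OF \<phi>]
    let ?p = "\<lambda>x. \<phi> x ^ (2 * Suc k)"
    let ?E = "\<integral>\<^sup>+x. ennreal (energy \<phi> x) \<partial>lborel"
    have p0: "?p x \<ge> 0" for x by (rule zero_le_even_power) simp
    \<comment> \<open>Membership in a ball of variable centre and radius is rewritten as a strict
      inequality of measurable functions, which gives the joint measurability for Tonelli.\<close>
    have [measurable]: "(\<lambda>p. indicator (ball (fst p) (rad (fst p))) (snd p) :: ennreal) \<in> borel_measurable (lborel \<Otimes>\<^sub>M lborel)"
    proof -
      have "(\<lambda>p. indicator (ball (fst p) (rad (fst p))) (snd p) :: ennreal) =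
          (\<lambda>p. if dist (fst p) (snd p) < rad (fst p) then 1 else 0)"
        by (auto simp: fun_eq_iff indicator_def)
      then show ?thesis by simp
    qed
    have [measurable]: "(\<lambda>\<xi>. indicator (ball \<xi> (rad \<xi>)) x :: ennreal) \<in> borel_measurable borel" for x
    proof -
      have "(\<lambda>\<xi>. indicator (ball \<xi> (rad \<xi>)) x :: ennreal) = (\<lambda>\<xi>. if dist \<xi> x < rad \<xi> then 1 else 0)"
        by (auto simp: fun_eq_iff indicator_def)
      then show ?thesis by simp
    qed
    have "ennreal c * (\<integral>\<^sup>+x. ennreal (V x * ?p x) \<partial>lborel) = (\<integral>\<^sup>+x. ennreal (?p x) * ennreal (c * V x) \<partial>lborel)"
      using c V_pos p0
      by (subst nn_integral_cmult[symmetric])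
        (auto intro!: nn_integral_cong simp: ennreal_mult'[symmetric] ennreal_mult''[symmetric] less_imp_le ac_simps)
    also have "\<dots> \<le> (\<integral>\<^sup>+x. ennreal (?p x) * (\<integral>\<^sup>+\<xi>. ennreal ((V \<xi>)\<^sup>2 * (cutoff (rad \<xi>) \<xi> x)\<^sup>2) \<partial>lborel) \<partial>lborel)"
      unfolding c_def by (intro nn_integral_mono mult_left_mono cutoff_average_lower) auto
    also have "\<dots> = (\<integral>\<^sup>+x. \<integral>\<^sup>+\<xi>. ennreal ((V \<xi>)\<^sup>2 * (cutoff (rad \<xi>) \<xi> x)\<^sup>2 * ?p x) \<partial>lborel \<partial>lborel)"
      unfolding cutoff_def using p0
      by (subst nn_integral_cmult[symmetric]) (auto intro!: nn_integral_cong simp: ennreal_mult[symmetric] ac_simps)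
    also have "\<dots> = (\<integral>\<^sup>+\<xi>. \<integral>\<^sup>+x. ennreal ((V \<xi>)\<^sup>2 * (cutoff (rad \<xi>) \<xi> x)\<^sup>2 * ?p x) \<partial>lborel \<partial>lborel)"
      by (rule lborel_pair.Fubini') (unfold cutoff_def, measurable)
    also have "\<dots> \<le> (\<integral>\<^sup>+\<xi>. ennreal (2 * D) * S * (\<integral>\<^sup>+x\<in>ball \<xi> (rad \<xi>). ennreal (V \<xi> * energy \<phi> x) \<partial>lborel) \<partial>lborel)"
      unfolding D_def by (intro nn_integral_mono local_inequality \<phi> S)
    also have "\<dots> = ennreal (2 * D) * S * (\<integral>\<^sup>+\<xi>. \<integral>\<^sup>+x. ennreal (V \<xi> * energy \<phi> x) * indicator (ball \<xi> (rad \<xi>)) x \<partial>lborel \<partial>lborel)"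
      by (rule nn_integral_cmult) measurable
    also have "(\<integral>\<^sup>+\<xi>. \<integral>\<^sup>+x. ennreal (V \<xi> * energy \<phi> x) * indicator (ball \<xi> (rad \<xi>)) x \<partial>lborel \<partial>lborel)
        = (\<integral>\<^sup>+x. \<integral>\<^sup>+\<xi>. ennreal (V \<xi> * energy \<phi> x) * indicator (ball \<xi> (rad \<xi>)) x \<partial>lborel \<partial>lborel)"
      by (rule lborel_pair.Fubini'[symmetric]) measurable
    also have "\<dots> = (\<integral>\<^sup>+x. ennreal (energy \<phi> x) * (\<integral>\<^sup>+\<xi>. ennreal (V \<xi>) * indicator (ball \<xi> (rad \<xi>)) x \<partial>lborel) \<partial>lborel)"
      using V_pos energy_nonneg
      by (subst nn_integral_cmult[symmetric])
        (auto intro!: nn_integral_cong simp: ennreal_mult less_imp_le ac_simps)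
    also have "\<dots> \<le> (\<integral>\<^sup>+x. ennreal (energy \<phi> x) * ennreal (8 * pi * \<rho>\<^sup>2) \<partial>lborel)"
      by (intro nn_integral_mono mult_left_mono ball_average_upper) auto
    also have "\<dots> = ?E * ennreal (8 * pi * \<rho>\<^sup>2)"
      by (rule nn_integral_multc) measurable
    finally have main: "ennreal c * (\<integral>\<^sup>+x. ennreal (V x * ?p x) \<partial>lborel)
        \<le> ennreal (2 * D) * S * (?E * ennreal (8 * pi * \<rho>\<^sup>2))"
      by this (auto intro: mult_left_mono)
    have "(\<integral>\<^sup>+x. ennreal (V x * ?p x) \<partial>lborel) = ennreal (1 / c) * (ennreal c * (\<integral>\<^sup>+x. ennreal (V x * ?p x) \<partial>lborel))"
      using c by (simp add: mult.assoc[symmetric] ennreal_mult[symmetric])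
    also have "\<dots> \<le> ennreal (1 / c) * (ennreal (2 * D) * S * (?E * ennreal (8 * pi * \<rho>\<^sup>2)))"
      by (intro mult_left_mono main) auto
    also have "\<dots> = ennreal K * S * ?E"
    proof -
      have "ennreal K = ennreal (1 / c) * (ennreal (2 * D) * ennreal (8 * pi * \<rho>\<^sup>2))"
        using c D unfolding K_def by (subst ennreal_mult, simp, simp, subst ennreal_mult) auto
      then show ?thesis by (simp only: ac_simps)
    qed
    finally show ?thesis .
  qed
  moreover have "K \<ge> 0" using c D by (simp add: K_def)
  ultimately show ?thesis by blast
qed

text \<open>The local bound \<open>S\<close> enters once, in the step from power 2 to power 4; each
  further step raises the power by 2 and costs one factor of the total energy. Smallness of
  \<open>S\<close> thus passes linearly to all higher even powers.\<close>

lemma iterated_inequality: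
  "\<exists>K\<ge>0. \<forall>\<phi> S. test_fun \<phi> \<longrightarrow>
     (\<forall>\<xi>. (\<integral>\<^sup>+x\<in>ball \<xi> (rad \<xi>). ennreal (V x * (\<phi> x)\<^sup>2) \<partial>lborel) \<le> S) \<longrightarrow>
     (\<integral>\<^sup>+x. ennreal (V x * \<phi> x ^ (2 * Suc (Suc k))) \<partial>lborel)
       \<le> ennreal K * S * (\<integral>\<^sup>+x. ennreal (energy \<phi> x) \<partial>lborel) ^ Suc k"
proof (induction k)
  case 0
  show ?case using global_inequality[of 1] unfolding mult_1_right by (simp only: One_nat_def power_Suc0_right)
next
  case (Suc k)
  from Suc obtain K1 where K1: "K1 \<ge> 0" "\<And>\<phi> S. test_fun \<phi> \<Longrightarrow>
     (\<And>\<xi>. (\<integral>\<^sup>+x\<in>ball \<xi> (rad \<xi>). ennreal (V x * (\<phi> x)\<^sup>2) \<partial>lborel) \<le> S) \<Longrightarrow>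
     (\<integral>\<^sup>+x. ennreal (V x * \<phi> x ^ (2 * Suc (Suc k))) \<partial>lborel)
       \<le> ennreal K1 * S * (\<integral>\<^sup>+x. ennreal (energy \<phi> x) \<partial>lborel) ^ Suc k" by blast
  from global_inequality[of "Suc (Suc k)"] obtain K2 where K2: "K2 \<ge> 0" "\<And>\<phi> S. test_fun \<phi> \<Longrightarrow>
     (\<And>\<xi>. (\<integral>\<^sup>+x\<in>ball \<xi> (rad \<xi>). ennreal (V x * \<phi> x ^ (2 * Suc (Suc k))) \<partial>lborel) \<le> S) \<Longrightarrow>
     (\<integral>\<^sup>+x. ennreal (V x * \<phi> x ^ (2 * Suc (Suc (Suc k)))) \<partial>lborel)
       \<le> ennreal K2 * S * (\<integral>\<^sup>+x. ennreal (energy \<phi> x) \<partial>lborel)" by blast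
  show ?case
  proof (intro exI[of _ "K2 * K1"] conjI allI impI)
    show "K2 * K1 \<ge> 0" using K1 K2 by simp
    fix \<phi> S assume \<phi>: "test_fun \<phi>"
      and S: "\<forall>\<xi>. (\<integral>\<^sup>+x\<in>ball \<xi> (rad \<xi>). ennreal (V x * (\<phi> x)\<^sup>2) \<partial>lborel) \<le> S"
    let ?E = "\<integral>\<^sup>+x. ennreal (energy \<phi> x) \<partial>lborel"
    \<comment> \<open>The integral of the previous power over the whole plane serves as the bound on
      its local integrals.\<close>
    have "(\<integral>\<^sup>+x. ennreal (V x * \<phi> x ^ (2 * Suc (Suc (Suc k)))) \<partial>lborel)
       \<le> ennreal K2 * (\<integral>\<^sup>+x. ennreal (V x * \<phi> x ^ (2 * Suc (Suc k))) \<partial>lborel) * ?E"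
      by (intro K2(2) \<phi> nn_integral_mono) (auto simp: indicator_def)
    also have "\<dots> \<le> ennreal K2 * (ennreal K1 * S * ?E ^ Suc k) * ?E"
      using S by (intro mult_right_mono mult_left_mono K1(2) \<phi>) auto
    also have "\<dots> = ennreal (K2 * K1) * S * ?E ^ Suc (Suc k)"
      using K1(1) K2(1) by (simp add: ennreal_mult ac_simps)
    finally show "(\<integral>\<^sup>+x. ennreal (V x * \<phi> x ^ (2 * Suc (Suc (Suc k)))) \<partial>lborel)
       \<le> ennreal (K2 * K1) * S * ?E ^ Suc (Suc k)" .
  qed
qed

text \<open>Test functions near \<open>u\<close> satisfy \<open>iterated_inequality\<close> with
  \<open>S\<close> and \<open>M\<close> doubled up to multiples of the error
  \<open>\<delta>\<close>, by |a|^2 \<le> 2 |b|^2 + 2 |a - b|^2, and Fatou carries the bound to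
  \<open>u\<close>. The error remains a free positive parameter, to be sent to 0 together with
  \<open>S\<close>.\<close>

lemma H1V_bound:
  "\<exists>K\<ge>0. \<forall>u g S M \<delta>. H1V V u g \<longrightarrow> \<delta> > 0 \<longrightarrow>
     (\<forall>\<xi>. (\<integral>\<^sup>+x\<in>ball \<xi> (rad \<xi>). ennreal (V x * (u x)\<^sup>2) \<partial>lborel) \<le> S) \<longrightarrow>
     H1V_norm2 V u g \<le> M \<longrightarrow>
     (\<integral>\<^sup>+x. ennreal (V x * u x ^ (2 * Suc (Suc k))) \<partial>lborel)
       \<le> ennreal K * (2 * S + 2 * \<delta>) * (2 * M + (2 * \<delta> + 2 * \<delta>)) ^ Suc k"
proof -
  obtain K where K: "K \<ge> 0" "\<And>\<phi> S. test_fun \<phi> \<Longrightarrow>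
     (\<And>\<xi>. (\<integral>\<^sup>+x\<in>ball \<xi> (rad \<xi>). ennreal (V x * (\<phi> x)\<^sup>2) \<partial>lborel) \<le> S) \<Longrightarrow>
     (\<integral>\<^sup>+x. ennreal (V x * \<phi> x ^ (2 * Suc (Suc k))) \<partial>lborel)
       \<le> ennreal K * S * (\<integral>\<^sup>+x. ennreal (energy \<phi> x) \<partial>lborel) ^ Suc k"
    using iterated_inequality[of k] by blast
  show ?thesis
  proof (intro exI[of _ K] conjI allI impI K(1))
    fix u g S M and \<delta> :: ennreal
    assume H: "H1V V u g" and \<delta>: "\<delta> > 0"
      and S: "\<forall>\<xi>. (\<integral>\<^sup>+x\<in>ball \<xi> (rad \<xi>). ennreal (V x * (u x)\<^sup>2) \<partial>lborel) \<le> S"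
      and M: "H1V_norm2 V u g \<le> M"
    let ?B = "ennreal K * (2 * S + 2 * \<delta>) * (2 * M + (2 * \<delta> + 2 * \<delta>)) ^ Suc k"
    have [measurable]: "u \<in> borel_measurable borel" "g \<in> borel_measurable borel"
      using H by (auto simp: H1V_def)
    obtain \<phi> where \<phi>: "\<And>k. test_fun (\<phi> k)"
      and l1: "(\<lambda>k. \<integral>\<^sup>+ x. ennreal (V x * (\<phi> k x - u x)^2) \<partial>lborel) \<longlonglongrightarrow> 0"
      and l2: "(\<lambda>k. \<integral>\<^sup>+ x. ennreal ((norm (grad (\<phi> k) x - g x))^2) \<partial>lborel) \<longlonglongrightarrow> 0"
      using H unfolding H1V_def by blast
    note [measurable] = test_fun_measurable[OF \<phi>]
    obtain s where s: "strict_mono s" "AE x in lborel. (\<lambda>j. \<phi> (s j) x) \<longlonglongrightarrow> u x"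
      using AE_subseq_of_weighted_L2[OF _ _ _ V_pos l1] by (metis V_measurable \<open>u \<in> borel_measurable borel\<close> test_fun_measurable(1)[OF \<phi>])
    have bound: "(\<integral>\<^sup>+x. ennreal (V x * \<phi> j x ^ (2 * Suc (Suc k))) \<partial>lborel) \<le> ?B"
      if e1: "(\<integral>\<^sup>+ x. ennreal (V x * (\<phi> j x - u x)^2) \<partial>lborel) \<le> \<delta>"
        and e2: "(\<integral>\<^sup>+ x. ennreal ((norm (grad (\<phi> j) x - g x))^2) \<partial>lborel) \<le> \<delta>" for j
    proof -
      have pw: "V x * (\<phi> j x)\<^sup>2 \<le> 2 * (V x * (u x)\<^sup>2) + 2 * (V x * (\<phi> j x - u x)\<^sup>2)" for x
        using mult_left_mono[OF square_le_double[of "\<phi> j x" "u x"], of "V x"] V_pos[of x]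
        by (simp add: algebra_simps)
      have "(\<integral>\<^sup>+x\<in>ball \<xi> (rad \<xi>). ennreal (V x * (\<phi> j x)\<^sup>2) \<partial>lborel) \<le> 2 * S + 2 * \<delta>" for \<xi>
      proof -
        have "(\<integral>\<^sup>+x\<in>ball \<xi> (rad \<xi>). ennreal (V x * (\<phi> j x)\<^sup>2) \<partial>lborel)
           \<le> (\<integral>\<^sup>+x. 2 * (ennreal (V x * (u x)\<^sup>2) * indicator (ball \<xi> (rad \<xi>)) x)
                + 2 * ennreal (V x * (\<phi> j x - u x)\<^sup>2) \<partial>lborel)"
        proof (rule nn_integral_mono)
          fix x
          have "ennreal (V x * (\<phi> j x)\<^sup>2) \<le> 2 * ennreal (V x * (u x)\<^sup>2) + 2 * ennreal (V x * (\<phi> j x - u x)\<^sup>2)"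
            using ennreal_leI[OF pw[of x]] V_pos[of x] by (simp add: ennreal_plus ennreal_mult'')
          then show "ennreal (V x * (\<phi> j x)\<^sup>2) * indicator (ball \<xi> (rad \<xi>)) x
            \<le> 2 * (ennreal (V x * (u x)\<^sup>2) * indicator (ball \<xi> (rad \<xi>)) x) + 2 * ennreal (V x * (\<phi> j x - u x)\<^sup>2)"
            by (auto simp: indicator_def)
        qed
        also have "\<dots> = 2 * (\<integral>\<^sup>+x\<in>ball \<xi> (rad \<xi>). ennreal (V x * (u x)\<^sup>2) \<partial>lborel)
            + 2 * (\<integral>\<^sup>+x. ennreal (V x * (\<phi> j x - u x)\<^sup>2) \<partial>lborel)"
          by (subst nn_integral_add) (auto simp: nn_integral_cmult)
        also have "\<dots> \<le> 2 * S + 2 * \<delta>"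
          using S e1 by (intro add_mono mult_left_mono) auto
        finally show ?thesis .
      qed
      then have "(\<integral>\<^sup>+x. ennreal (V x * \<phi> j x ^ (2 * Suc (Suc k))) \<partial>lborel)
       \<le> ennreal K * (2 * S + 2 * \<delta>) * (\<integral>\<^sup>+x. ennreal (energy (\<phi> j) x) \<partial>lborel) ^ Suc k"
        by (rule K(2)[OF \<phi>])
      also have "(\<integral>\<^sup>+x. ennreal (energy (\<phi> j) x) \<partial>lborel) \<le> 2 * M + (2 * \<delta> + 2 * \<delta>)"
      proof -
        have "(\<integral>\<^sup>+x. ennreal (energy (\<phi> j) x) \<partial>lborel)
           \<le> (\<integral>\<^sup>+x. 2 * ennreal ((norm (g x))\<^sup>2 + V x * (u x)\<^sup>2)
                + (2 * ennreal (V x * (\<phi> j x - u x)\<^sup>2) + 2 * ennreal ((norm (grad (\<phi> j) x - g x))^2)) \<partial>lborel)"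
        proof (rule nn_integral_mono)
          fix x
          have "energy (\<phi> j) x \<le> 2 * ((norm (g x))\<^sup>2 + V x * (u x)\<^sup>2)
              + (2 * (V x * (\<phi> j x - u x)\<^sup>2) + 2 * (norm (grad (\<phi> j) x - g x))\<^sup>2)"
            using pw[of x] square_le_double[of "grad (\<phi> j) x" "g x"] by (simp add: energy_def)
          from ennreal_leI[OF this] show "ennreal (energy (\<phi> j) x) \<le> 2 * ennreal ((norm (g x))\<^sup>2 + V x * (u x)\<^sup>2)
                + (2 * ennreal (V x * (\<phi> j x - u x)\<^sup>2) + 2 * ennreal ((norm (grad (\<phi> j) x - g x))^2))"
            using V_pos[of x] by (simp add: ennreal_plus ennreal_mult'' del: distrib_left_numeral)
        qed
        also have "\<dots> = 2 * H1V_norm2 V u g + (2 * (\<integral>\<^sup>+x. ennreal (V x * (\<phi> j x - u x)\<^sup>2) \<partial>lborel)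
            + 2 * (\<integral>\<^sup>+x. ennreal ((norm (grad (\<phi> j) x - g x))^2) \<partial>lborel))"
          unfolding H1V_norm2_def
          by (subst nn_integral_add, simp, simp, subst nn_integral_add) (auto simp: nn_integral_cmult)
        also have "\<dots> \<le> 2 * M + (2 * \<delta> + 2 * \<delta>)"
          by (intro add_mono mult_left_mono M e1 e2) auto
        finally show ?thesis .
      qed
      finally show ?thesis by this (intro mult_left_mono power_mono, auto)
    qed
    have "eventually (\<lambda>j. (\<integral>\<^sup>+ x. ennreal (V x * (\<phi> j x - u x)^2) \<partial>lborel) \<le> \<delta> \<and>
        (\<integral>\<^sup>+ x. ennreal ((norm (grad (\<phi> j) x - g x))^2) \<partial>lborel) \<le> \<delta>) sequentially"
      using order_tendstoD(2)[OF l1 \<delta>] order_tendstoD(2)[OF l2 \<delta>]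
      by eventually_elim auto
    then have "eventually (\<lambda>j. (\<integral>\<^sup>+x. ennreal (V x * \<phi> j x ^ (2 * Suc (Suc k))) \<partial>lborel) \<le> ?B) sequentially"
      by (rule eventually_mono) (blast intro: bound)
    then have ev: "eventually (\<lambda>j. (\<integral>\<^sup>+x. ennreal (V x * \<phi> (s j) x ^ (2 * Suc (Suc k))) \<partial>lborel) \<le> ?B) sequentially"
      by (rule eventually_subseq[OF s(1)])
    \<comment> \<open>Fatou along the almost everywhere convergent subsequence, on which the bound
      \<open>?B\<close> holds from some index on.\<close>
    have "(\<integral>\<^sup>+x. ennreal (V x * u x ^ (2 * Suc (Suc k))) \<partial>lborel)
        = (\<integral>\<^sup>+x. liminf (\<lambda>j. ennreal (V x * \<phi> (s j) x ^ (2 * Suc (Suc k)))) \<partial>lborel)"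
    proof (rule nn_integral_cong_AE)
      show "AE x in lborel. ennreal (V x * u x ^ (2 * Suc (Suc k)))
          = liminf (\<lambda>j. ennreal (V x * \<phi> (s j) x ^ (2 * Suc (Suc k))))"
        using s(2)
      proof eventually_elim
        case (elim x)
        have "(\<lambda>j. ennreal (V x * \<phi> (s j) x ^ (2 * Suc (Suc k)))) \<longlonglongrightarrow> ennreal (V x * u x ^ (2 * Suc (Suc k)))"
          by (intro tendsto_intros elim)
        then show ?case by (simp add: lim_imp_Liminf del: mult_Suc_right power_Suc)
      qed
    qed
    also have "\<dots> \<le> liminf (\<lambda>j. \<integral>\<^sup>+x. ennreal (V x * \<phi> (s j) x ^ (2 * Suc (Suc k))) \<partial>lborel)"
      by (rule nn_integral_liminf) measurable
    also have "\<dots> \<le> ?B"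
      using Liminf_mono[OF ev] by (simp add: Liminf_const del: mult_Suc_right power_Suc)
    finally show "(\<integral>\<^sup>+x. ennreal (V x * u x ^ (2 * Suc (Suc k))) \<partial>lborel) \<le> ?B" .
  qed
qed

end

section \<open>Vanishing\<close>

text \<open>Splits at b = \<open>\<eta> powr (1 / (\<tau> - 2))\<close>: up to b, t^(\<tau>-2) \<le>
  \<eta>; beyond b the exponent \<tau> - m is not positive, so t^(\<tau>-m) \<le>
  b^(\<tau>-m).\<close>

lemma powr_interpolation:
  fixes t \<tau> \<eta> :: real
  assumes "t \<ge> 0" "\<tau> > 2" "\<eta> > 0" "\<tau> \<le> real m"
  shows "t powr \<tau> \<le> \<eta> * t\<^sup>2 + (\<eta> powr (1 / (\<tau> - 2))) powr (\<tau> - real m) * t ^ m"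
proof -
  define b where "b = \<eta> powr (1 / (\<tau> - 2))"
  have b: "b > 0" "b powr (\<tau> - 2) = \<eta>" using assms by (auto simp: b_def powr_powr)
  consider "t = 0" | "0 < t" "t \<le> b" | "t > b" using assms by linarith
  then show ?thesis
  proof cases
    case 1 then show ?thesis using assms by (simp add: zero_le_mult_iff)
  next
    case 2
    have "t powr \<tau> = t powr (\<tau> - 2) * t\<^sup>2"
      using 2 powr_add[of t "\<tau> - 2" 2] by (simp add: powr_numeral)
    also have "\<dots> \<le> b powr (\<tau> - 2) * t\<^sup>2"
      using 2 assms by (intro mult_right_mono powr_mono2) auto
    finally have "t powr \<tau> \<le> \<eta> * t\<^sup>2" using b by simp
    moreover have "0 \<le> b powr (\<tau> - real m) * t ^ m" using 2 by simp
    ultimately show ?thesis by (simp add: b_def)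
  next
    case 3
    then have t: "t > 0" using b by linarith
    have "t powr \<tau> = t powr (\<tau> - real m) * t ^ m"
      using t powr_add[of t "\<tau> - real m" "real m"] by (simp add: powr_realpow)
    also have "\<dots> \<le> b powr (\<tau> - real m) * t ^ m"
      using 3 assms b t by (intro mult_right_mono powr_mono2') auto
    finally show ?thesis using assms by (simp add: b_def add_increasing)
  qed
qed

theorem lemma3p6:
  fixes V :: "(real^2) \<Rightarrow> real" and u :: "nat \<Rightarrow> (real^2) \<Rightarrow> real"
    and C r :: real
  assumes V_cont: "continuous_on UNIV V"
    and V_inf: "\<exists>c>0. \<forall>x. V x \<ge> c"
    and C_pos: "C > 0"
    and V_weak_grad: "\<exists>G :: (real^2) \<Rightarrow> real^2.
         (\<forall>i. \<forall>K. compact K \<longrightarrow> set_integrable lborel K (\<lambda>x. G x $ i)) \<and>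
         (\<forall>\<phi> i. test_fun \<phi> \<longrightarrow>
             (\<integral>x. V x * partial \<phi> i x \<partial>lborel) = - (\<integral>x. G x $ i * \<phi> x \<partial>lborel)) \<and>
         (AE x in lborel. norm (G x) \<le> C * V x powr (3/2))"
    and bounded: "\<exists>M::real. \<forall>n. \<exists>g. H1V V (u n) g \<and> H1V_norm2 V (u n) g \<le> ennreal M"
    and r_pos: "r > 0"
    and vanish: "(\<lambda>n. SUP \<xi>. \<integral>\<^sup>+ x\<in>ball \<xi> r. ennreal (V x * (u n x)^2) \<partial>lborel) \<longlonglongrightarrow> 0"
  shows "\<forall>\<tau>>2. (\<lambda>n. LV_pow V \<tau> (u n)) \<longlonglongrightarrow> 0"
proof (intro allI impI)
  fix \<tau> :: real assume \<tau>: "\<tau> > 2"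
  obtain c where c: "c > 0" "\<And>x. V x \<ge> c" using V_inf by blast
  have Vpos: "V x > 0" for x using c(1) c(2)[of x] by linarith
  obtain G where G: "\<And>\<phi> i. test_fun \<phi> \<Longrightarrow>
             (\<integral>x. V x * partial \<phi> i x \<partial>lborel) = - (\<integral>x. G x $ i * \<phi> x \<partial>lborel)"
         "AE x in lborel. norm (G x) \<le> C * V x powr (3/2)"
    using V_weak_grad by blast
  obtain M0 :: real and g where g: "\<And>n. H1V V (u n) (g n)" "\<And>n. H1V_norm2 V (u n) (g n) \<le> ennreal M0"
    using bounded by metis
  \<comment> \<open>The first entry is the range of comparability from the gradient condition; the
    second gives \<open>rad \<xi> \<le> r\<close> because \<open>V\<close> is at least
    \<open>c\<close>, so the vanishing hypothesis covers the smaller balls.\<close>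
  define \<rho> where "\<rho> = min (1 / (12 * C)) (r * sqrt c)"
  have \<rho>: "\<rho> > 0" using C_pos r_pos c by (simp add: \<rho>_def)
  interpret comparable_weight V \<rho>
  proof
    fix \<xi> x assume d: "dist \<xi> x \<le> \<rho> / sqrt (V \<xi>)"
    have "\<rho> / sqrt (V \<xi>) \<le> 1 / (12 * C) / sqrt (V \<xi>)"
      using Vpos[of \<xi>] by (intro divide_right_mono) (auto simp: \<rho>_def)
    with d have "dist \<xi> x \<le> 1 / (12 * C * sqrt (V \<xi>))" by simp
    from comparable_of_weak_grad[OF V_cont Vpos G C_pos this]
    show "V \<xi> \<le> 2 * V x \<and> V x \<le> 2 * V \<xi>" by simp
  qed (use V_cont Vpos \<rho> in auto)
  have rad_le_r: "rad \<xi> \<le> r" for \<xi>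
  proof -
    have "\<rho> / sqrt (V \<xi>) \<le> \<rho> / sqrt c"
      using \<rho> c Vpos[of \<xi>] by (intro divide_left_mono) auto
    also have "\<dots> \<le> (r * sqrt c) / sqrt c"
      using c by (intro divide_right_mono) (auto simp: \<rho>_def)
    finally show ?thesis using c by (simp add: rad_def)
  qed
  define S where "S n = (SUP \<xi>. \<integral>\<^sup>+ x\<in>ball \<xi> r. ennreal (V x * (u n x)^2) \<partial>lborel)" for n
  have S: "(\<integral>\<^sup>+x\<in>ball \<xi> (rad \<xi>). ennreal (V x * (u n x)\<^sup>2) \<partial>lborel) \<le> S n" for n \<xi>
  proof -
    have "(\<integral>\<^sup>+x\<in>ball \<xi> (rad \<xi>). ennreal (V x * (u n x)\<^sup>2) \<partial>lborel) \<le> (\<integral>\<^sup>+x\<in>ball \<xi> r. ennreal (V x * (u n x)\<^sup>2) \<partial>lborel)"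
      using rad_le_r[of \<xi>] by (intro nn_integral_mono) (auto simp: indicator_def)
    also have "\<dots> \<le> S n" unfolding S_def by (rule SUP_upper) simp
    finally show ?thesis .
  qed
  \<comment> \<open>The resulting exponent \<open>m\<close> is even, so that
    \<open>u n x ^ m\<close> is |u|^m, and at least \<open>\<tau>\<close>, as the interpolation
    requires.\<close>
  define k where "k = nat \<lceil>\<tau>\<rceil>"
  define m where "m = 2 * Suc (Suc k)"
  have m: "\<tau> \<le> real m" using real_nat_ceiling_ge[of \<tau>] unfolding m_def k_def by simp
  obtain K where K: "K \<ge> 0" "\<And>u g S M \<delta>. H1V V u g \<Longrightarrow> \<delta> > 0 \<Longrightarrow>
     (\<And>\<xi>. (\<integral>\<^sup>+x\<in>ball \<xi> (rad \<xi>). ennreal (V x * (u x)\<^sup>2) \<partial>lborel) \<le> S) \<Longrightarrow>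
     H1V_norm2 V u g \<le> M \<Longrightarrow>
     (\<integral>\<^sup>+x. ennreal (V x * u x ^ m) \<partial>lborel)
       \<le> ennreal K * (2 * S + 2 * \<delta>) * (2 * M + (2 * \<delta> + 2 * \<delta>)) ^ Suc k"
    using H1V_bound[of k] unfolding m_def by blast
  define A where "A n = (\<integral>\<^sup>+x. ennreal (V x * u n x ^ m) \<partial>lborel)" for n
  \<comment> \<open>The error is taken as 1/(n+1) \<le> 1, which bounds the energy factor
    independently of n. Finiteness of \<open>B\<close> lets its product with a null sequence tend to
    0 in \<open>ennreal\<close>.\<close>
  define B where "B = ennreal K * (2 * ennreal M0 + (2 * 1 + 2 * 1)) ^ Suc k"
  have A_le: "A n \<le> B * (2 * S n + 2 * ennreal (inverse (real (Suc n))))" for n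
  proof -
    have d: "ennreal (inverse (real (Suc n))) \<le> 1"
      using ennreal_leI[of "inverse (real (Suc n))" 1] by (simp add: inverse_le_1_iff)
    have "A n \<le> ennreal K * (2 * S n + 2 * ennreal (inverse (real (Suc n)))) *
        (2 * ennreal M0 + (2 * ennreal (inverse (real (Suc n))) + 2 * ennreal (inverse (real (Suc n))))) ^ Suc k"
      unfolding A_def by (intro K(2)[OF g(1) _ S g(2)]) simp
    also have "\<dots> \<le> ennreal K * (2 * S n + 2 * ennreal (inverse (real (Suc n)))) * (2 * ennreal M0 + (2 * 1 + 2 * 1)) ^ Suc k"
      by (intro mult_left_mono power_mono add_mono d order_refl) auto
    finally show ?thesis by (simp add: B_def ac_simps)
  qed
  have B: "B < top"
    unfolding B_def by (auto simp: ennreal_mult_less_top power_less_top_ennreal simp del: power_Suc)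
  have A0: "A \<longlonglongrightarrow> 0"
  proof (rule tendsto_sandwich[OF _ _ tendsto_const])
    have i: "(\<lambda>n. ennreal (inverse (real (Suc n)))) \<longlonglongrightarrow> ennreal 0"
      by (intro tendsto_ennrealI LIMSEQ_inverse_real_of_nat)
    have "(\<lambda>n. B * (2 * S n + 2 * ennreal (inverse (real (Suc n))))) \<longlonglongrightarrow> B * (2 * 0 + 2 * ennreal 0)"
      using vanish[folded S_def] B by (intro ennreal_tendsto_cmult tendsto_add i) auto
    then show "(\<lambda>n. B * (2 * S n + 2 * ennreal (inverse (real (Suc n))))) \<longlonglongrightarrow> 0" by simp
  qed (use A_le in auto)
  have umeas [measurable]: "u n \<in> borel_measurable borel" for n
    using g(1)[of n] by (simp add: H1V_def)
  show "(\<lambda>n. LV_pow V \<tau> (u n)) \<longlonglongrightarrow> 0"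
  proof (rule order_tendstoI)
    fix y :: ennreal assume "0 < y"
    \<comment> \<open>A finite target below \<open>y\<close>, which may itself be infinite.\<close>
    then obtain z where z: "0 < z" "z < y" using dense by blast
    then obtain e where e: "z = ennreal e" "e > 0"
      by (cases z) auto
    \<comment> \<open>Makes \<eta> |M0| \<le> e/2; the added 1 keeps the denominator
      positive.\<close>
    define \<eta> where "\<eta> = e / (2 * (\<bar>M0\<bar> + 1))"
    have \<eta>: "\<eta> > 0" using e by (simp add: \<eta>_def)
    define a where "a = (\<eta> powr (1 / (\<tau> - 2))) powr (\<tau> - real m)"
    have le: "LV_pow V \<tau> (u n) \<le> ennreal (e / 2) + ennreal a * A n" for n
    proof -
      \<comment> \<open>The squared gradient is added to the quadratic term so that the bounded
        quantity \<open>H1V_norm2\<close> appears.\<close>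
      have "LV_pow V \<tau> (u n) \<le> (\<integral>\<^sup>+x. ennreal \<eta> * ennreal ((norm (g n x))\<^sup>2 + V x * (u n x)\<^sup>2) + ennreal a * ennreal (V x * u n x ^ m) \<partial>lborel)"
        unfolding LV_pow_def
      proof (rule nn_integral_mono)
        fix x
        have ev: "\<bar>u n x\<bar> ^ m = u n x ^ m" by (simp add: m_def power_even_abs)
        have nn: "u n x ^ m \<ge> 0" unfolding m_def by (rule zero_le_even_power) simp
        have "\<bar>u n x\<bar> powr \<tau> \<le> \<eta> * (u n x)\<^sup>2 + a * u n x ^ m"
          using powr_interpolation[OF _ \<tau> \<eta> m, of "\<bar>u n x\<bar>"] by (simp add: a_def ev)
        then have "V x * \<bar>u n x\<bar> powr \<tau> \<le> V x * (\<eta> * (u n x)\<^sup>2 + a * u n x ^ m)"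
          using Vpos[of x] by (intro mult_left_mono) auto
        also have "\<dots> \<le> \<eta> * ((norm (g n x))\<^sup>2 + V x * (u n x)\<^sup>2) + a * (V x * u n x ^ m)"
          using \<eta> by (simp add: algebra_simps)
        finally show "ennreal (V x * \<bar>u n x\<bar> powr \<tau>) \<le> ennreal \<eta> * ennreal ((norm (g n x))\<^sup>2 + V x * (u n x)\<^sup>2) + ennreal a * ennreal (V x * u n x ^ m)"
          using \<eta> nn Vpos[of x]
          by (subst (1 2) ennreal_mult[symmetric]) (auto simp: a_def ennreal_plus[symmetric] intro!: ennreal_leI simp del: ennreal_plus)
      qed
      also have "\<dots> = ennreal \<eta> * H1V_norm2 V (u n) (g n) + ennreal a * A n"
      proof -
        have [measurable]: "g n \<in> borel_measurable borel" using g(1)[of n] by (simp add: H1V_def)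
        show ?thesis unfolding H1V_norm2_def A_def
          by (subst nn_integral_add) (auto simp: nn_integral_cmult)
      qed
      also have "\<dots> \<le> ennreal (e / 2) + ennreal a * A n"
      proof (rule add_right_mono)
        have "ennreal \<eta> * H1V_norm2 V (u n) (g n) \<le> ennreal \<eta> * ennreal \<bar>M0\<bar>"
          by (intro mult_left_mono order_trans[OF g(2)] ennreal_leI) auto
        also have "\<dots> = ennreal (\<eta> * \<bar>M0\<bar>)" using \<eta> by (simp add: ennreal_mult)
        also have "\<dots> \<le> ennreal (e / 2)"
        proof (rule ennreal_leI)
          have "\<eta> * \<bar>M0\<bar> \<le> \<eta> * (\<bar>M0\<bar> + 1)" using \<eta> by simp
          also have "\<dots> = e / 2" unfolding \<eta>_def by (simp add: field_simps add_pos_nonneg)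
          finally show "\<eta> * \<bar>M0\<bar> \<le> e / 2" .
        qed
        finally show "ennreal \<eta> * H1V_norm2 V (u n) (g n) \<le> ennreal (e / 2)" .
      qed
      finally show ?thesis .
    qed
    have "(\<lambda>n. ennreal a * A n) \<longlonglongrightarrow> ennreal a * 0"
      by (intro ennreal_tendsto_cmult A0) simp
    then have "eventually (\<lambda>n. ennreal a * A n < ennreal (e / 2)) sequentially"
      using e by (intro order_tendstoD(2)) auto
    then show "eventually (\<lambda>n. LV_pow V \<tau> (u n) < y) sequentially"
    proof eventually_elim
      case (elim n)
      have "LV_pow V \<tau> (u n) \<le> ennreal (e / 2) + ennreal a * A n" by (rule le)
      also have "\<dots> \<le> ennreal (e / 2) + ennreal (e / 2)" using elim by (intro add_left_mono) auto
      also have "\<dots> = z" using e by (simp add: ennreal_plus[symmetric] del: ennreal_plus)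
      finally show ?case using z by simp
    qed
  qed simp
qed

end
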